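(* Let $\tau>0$, assume $A=B$, and let $$\mathcal{A}=\begin{pmatrix}\tau A & M\\ M & -\tau B\end{pmatrix},\qquad \tilde{\mathcal{B}}=\begin{pmatrix}\tau A & M\\ \bar M & -\tau B\end{pmatrix}.$$ Let $C_1\in(0,1)$ be the constant, independent of $h$, in the norm equivalence $C_1(\bar M w,w)\le (Mw,w)\le(\bar M w,w)$ for all $w\in\mathbb{R}^{N_h}$. Then the GMRes iteration for the system with matrix $R=\mathcal{A}\tilde{\mathcal{B}}^{-1}$ converges with an asymptotic linear convergence rate bounded by $$\theta=\frac{1-C_1/2}{1+C_1}.$$ Moreover, for all $k$, $$\frac{\|r_k\|_2}{\|r_0\|_2}\le C_0\,\theta^k,\qquad C_0=\frac{2^{2m-1}C_R^m\,\dim\mathbb{V}_{\mathcal{T}}}{C_1^{m-1}} .$$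
   Context: Let $\Omega\subset\mathbb{R}^d$, $d\ge 1$, be a bounded polyhedral domain. The diffusion coefficients $a(x),b(x)$ are measurable (scalar, or symmetric matrix valued) functions on $\Omega$ satisfying the continuity and coercivity conditions $\lambda_a(x)|\xi|^2\le \xi^Ta(x)\xi\le\Lambda_a(x)|\xi|^2$ and $\lambda_b(x)|\xi|^2\le \xi^Tb(x)\xi\le\Lambda_b(x)|\xi|^2$ for all $\xi\in\mathbb{R}^d$, where $\lambda_a,\lambda_b$ are bounded below by positive constants and $\Lambda_a,\Lambda_b$ are bounded above. Let $\mathcal{T}$ be a shape-regular triangulation of $\Omega$ with meshsize $h$, and let $\mathbb{V}_{\mathcal{T}}\subset H^1_0(\Omega)$ be the space of continuous piecewise linear finite element functions over $\mathcal{T}$ vanishing on $\partial\Omega$, with nodal basis $\phi_1,\dots,\phi_{N_h}$, $N_h=\dim\mathbb{V}_{\mathcal{T}}$. Define the $N_h\times N_h$ matrices $$M_{ij}=\int_\Omega\phi_i\phi_j,\quad A_{ij}=\int_\Omega a\nabla\phi_i\cdot\nabla\phi_j,\quad B_{ij}=\int_\Omega b\nabla\phi_i\cdot\nabla\phi_j .$$ The lumped mass matrix $\bar M$ is the diagonal matrix whose diagonal entries are the row sums of $M$. $(\cdot,\cdot)$ applied to vectors is the Euclidean inner product. A constant $C_1\in(0,1)$ independent of $h$ with $C_1(\bar M w,w)\le (Mw,w)\le(\bar M w,w)$ for all $w\in\mathbb{R}^{N_h}$ is known to exist and is fixed. No relation between $\tau$ and $h$ is assumed. GMRes: to solve $Rv=b$,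 start from an initial iterate $v_0$ with residual $r_0=b-Rv_0\ne 0$; the residuals $r_k=b-Rv_k$ of the iterates $v_k$ satisfy $\|r_k\|_2=\min\{\|p(R)r_0\|_2: p \text{ a polynomial of degree}\le k,\ p(0)=1\}$, with $\|\cdot\|_2$ the Euclidean norm. "Asymptotic linear convergence rate bounded by $\theta$" means $\|r_k\|_2\le c\,\theta^k\|r_0\|_2$ for all $k$ with a constant $c$ independent of $k$. Constants: $R$ is a square matrix of order $n=2N_h$; $V$ is a nonsingular matrix transforming $R$ into its Jordan canonical form $J$, i.e. $V^{-1}RV=J$; $\kappa(V)$ is the condition number of $V$; $p$ is the number of Jordan blocks and $m$ is the size of the largest Jordan block of $R$; and $C_R:=n(1+\sqrt{n-p})\,\kappa(V)$. *)

theory Defs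
  imports
    "HOL-Analysis.Analysis"
    "HOL-Library.Function_Algebras"
    "Jordan_Normal_Form.Jordan_Normal_Form_Existence"
begin

text \<open>
  Geometric vectors live in \<open>real^'d\<close> (HOL-Analysis). Coordinate vectors and system matrices,
  whose size depends on the mesh, are the carrier-based ones of Jordan_Normal_Form.
  The symbols used by both libraries are reserved for HOL-Analysis.
\<close>

no_notation Matrix.vec_index (infixl "$" 100)
no_notation Matrix.scalar_prod (infix "\<bullet>" 70)

subsection \<open>Domain and triangulation\<close>

definition polyhedral_domain :: "(real^'d) set \<Rightarrow> bool" where
  "polyhedral_domain \<Omega> \<longleftrightarrow>
     open \<Omega> \<and> connected \<Omega> \<and> \<Omega> \<noteq> {} \<and> bounded \<Omega> \<and>
     (\<exists>\<F>. finite \<F> \<and> (\<forall>P\<in>\<F>. polytope P \<and> aff_dim P = int CARD('d) - 1) \<and>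
          frontier \<Omega> = \<Union>\<F>)"

text \<open>
  The last condition says that the mesh resolves the boundary. It only matters for domains that
  lie on both sides of a part of their boundary.
\<close>

definition domain_triangulation :: "(real^'d) set \<Rightarrow> (real^'d) set set \<Rightarrow> bool" where
  "domain_triangulation \<Omega> \<T> \<longleftrightarrow>
     triangulation \<T> \<and> (\<forall>T\<in>\<T>. int CARD('d) simplex T) \<and> \<Union>\<T> = closure \<Omega> \<and>
     (\<exists>\<F>. (\<forall>F\<in>\<F>. \<exists>T\<in>\<T>. F facet_of T) \<and> frontier \<Omega> = \<Union>\<F>)"

definition inradius :: "(real^'d) set \<Rightarrow> real" where
  "inradius T = Sup {r. \<exists>x. cball x r \<subseteq> T}"

text \<open>
  Shape regularity is a property of a family of meshes: one bound \<open>\<sigma>\<close> for all of them,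
  with no restriction on the meshsizes.
\<close>

definition shape_regular_family ::
    "(real^'d) set \<Rightarrow> real \<Rightarrow> (real^'d) set set set \<Rightarrow> bool" where
  "shape_regular_family \<Omega> \<sigma> \<TT> \<longleftrightarrow>
     (\<forall>\<T>\<in>\<TT>. domain_triangulation \<Omega> \<T> \<and>
        (\<forall>T\<in>\<T>. diameter T \<le> \<sigma> * (2 * inradius T)))"

subsection \<open>Diffusion coefficients\<close>

definition diffusion_coefficient :: "(real^'d) set \<Rightarrow> (real^'d \<Rightarrow> real^'d^'d) \<Rightarrow> bool" where
  "diffusion_coefficient \<Omega> a \<longleftrightarrow>
     a \<in> borel_measurable (lebesgue_on \<Omega>) \<and>
     (\<forall>x\<in>\<Omega>. Finite_Cartesian_Product.transpose (a x) = a x) \<and>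
     (\<exists>lo up :: real^'d \<Rightarrow> real. \<exists>c C.
        0 < c \<and> (\<forall>x\<in>\<Omega>. c \<le> lo x \<and> up x \<le> C) \<and>
        (\<forall>x\<in>\<Omega>. \<forall>\<xi>. lo x * (norm \<xi>)\<^sup>2 \<le> \<xi> \<bullet> (a x *v \<xi>) \<and>
                      \<xi> \<bullet> (a x *v \<xi>) \<le> up x * (norm \<xi>)\<^sup>2))"

subsection \<open>Finite element space\<close>

global_interpretation fun_vs: vector_space "\<lambda>(c::real) (f :: 'x \<Rightarrow> real) x. c * f x"
  by unfold_locales (auto simp: fun_eq_iff algebra_simps)

text \<open>
  Elements are extended by zero to the whole space, so that equality of functions on the
  closure of \<open>\<Omega>\<close> is equality in HOL.
\<close>

definition fe_space :: "(real^'d) set \<Rightarrow> (real^'d) set set \<Rightarrow> (real^'d \<Rightarrow> real) set" where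
  "fe_space \<Omega> \<T> =
     {u. continuous_on (closure \<Omega>) u \<and>
         (\<forall>T\<in>\<T>. \<exists>g c. \<forall>x\<in>T. u x = g \<bullet> x + c) \<and>
         (\<forall>x. x \<notin> \<Omega> \<longrightarrow> u x = 0)}"

definition fe_dim :: "(real^'d) set \<Rightarrow> (real^'d) set set \<Rightarrow> nat" where
  "fe_dim \<Omega> \<T> = fun_vs.dim (fe_space \<Omega> \<T>)"

definition interior_nodes :: "(real^'d) set \<Rightarrow> (real^'d) set set \<Rightarrow> (real^'d) set" where
  "interior_nodes \<Omega> \<T> = {z \<in> \<Omega>. \<exists>T\<in>\<T>. z extreme_point_of T}"

definition nodal_basis ::
    "(real^'d) set \<Rightarrow> (real^'d) set set \<Rightarrow> (nat \<Rightarrow> real^'d \<Rightarrow> real) \<Rightarrow> bool" where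
  "nodal_basis \<Omega> \<T> \<phi> \<longleftrightarrow>
     (let N = fe_dim \<Omega> \<T> in
        inj_on \<phi> {..<N} \<and> fun_vs.independent (\<phi> ` {..<N}) \<and>
        fun_vs.span (\<phi> ` {..<N}) = fe_space \<Omega> \<T> \<and>
        (\<exists>z. bij_betw z {..<N} (interior_nodes \<Omega> \<T>) \<and>
             (\<forall>i<N. \<forall>j<N. \<phi> i (z j) = of_bool (i = j))))"

subsection \<open>System matrices\<close>

text \<open>
  The value of \<open>grad\<close> at points of non-differentiability is arbitrary. For the piecewise linear
  functions considered here these points lie on the mesh skeleton, a null set, and off that set
  \<open>grad\<close> is the weak gradient.
\<close>

definition grad :: "(real^'d \<Rightarrow> real) \<Rightarrow> real^'d \<Rightarrow> real^'d" where
  "grad f x = (THE D. GDERIV f x :> D)"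

definition mass_matrix :: "(real^'d) set \<Rightarrow> nat \<Rightarrow> (nat \<Rightarrow> real^'d \<Rightarrow> real) \<Rightarrow> real mat" where
  "mass_matrix \<Omega> N \<phi> = Matrix.mat N N (\<lambda>(i, j). LINT x:\<Omega>|lebesgue. \<phi> i x * \<phi> j x)"

definition stiffness_matrix ::
    "(real^'d) set \<Rightarrow> (real^'d \<Rightarrow> real^'d^'d) \<Rightarrow> nat \<Rightarrow> (nat \<Rightarrow> real^'d \<Rightarrow> real) \<Rightarrow> real mat" where
  "stiffness_matrix \<Omega> a N \<phi> =
     Matrix.mat N N (\<lambda>(i, j). LINT x:\<Omega>|lebesgue. (a x *v grad (\<phi> i) x) \<bullet> grad (\<phi> j) x)"

definition lumped :: "real mat \<Rightarrow> real mat" where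
  "lumped M = mat_diag (dim_row M) (\<lambda>i. \<Sum>j<dim_col M. M $$ (i, j))"

definition mat_inv :: "'a :: field mat \<Rightarrow> 'a mat" where
  "mat_inv A = the (mat_inverse A)"

subsection \<open>Euclidean norm and condition number\<close>

definition vnorm :: "'a :: real_normed_vector Matrix.vec \<Rightarrow> real" where
  "vnorm v = L2_set (\<lambda>i. norm (vec_index v i)) {..<dim_vec v}"

definition spectral_norm :: "'a :: real_normed_field mat \<Rightarrow> real" where
  "spectral_norm A = Sup {vnorm (A *\<^sub>v x) | x. x \<in> carrier_vec (dim_col A) \<and> vnorm x \<le> 1}"

definition condition_number :: "'a :: real_normed_field mat \<Rightarrow> real" where
  "condition_number V = spectral_norm V * spectral_norm (mat_inv V)"

subsection \<open>Jordan canonical form\<close>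

text \<open>
  A list \<open>n_as\<close> of pairs (size, eigenvalue) describes the Jordan blocks. A real matrix is
  transformed over the complex numbers.
\<close>

definition jordan_transformation ::
    "real mat \<Rightarrow> complex mat \<Rightarrow> (nat \<times> complex) list \<Rightarrow> bool" where
  "jordan_transformation R V n_as \<longleftrightarrow>
     V \<in> carrier_mat (dim_row R) (dim_row R) \<and> invertible_mat V \<and>
     0 \<notin> fst ` set n_as \<and>
     mat_inv V * map_mat complex_of_real R * V = jordan_matrix n_as"

definition num_blocks :: "(nat \<times> complex) list \<Rightarrow> nat" where
  "num_blocks n_as = length n_as"

definition max_block_size :: "(nat \<times> complex) list \<Rightarrow> nat" where
  "max_block_size n_as = Max (fst ` set n_as)"

definition C_R :: "real mat \<Rightarrow> complex mat \<Rightarrow> (nat \<times> complex) list \<Rightarrow> real" where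
  "C_R R V n_as =
     (let n = real (dim_row R)
      in n * (1 + sqrt (n - real (num_blocks n_as))) * condition_number V)"

subsection \<open>GMRes\<close>

definition mat_poly :: "real poly \<Rightarrow> real mat \<Rightarrow> real mat" where
  "mat_poly p R = Matrix.mat (dim_row R) (dim_row R)
     (\<lambda>(i, j). \<Sum>k\<le>degree p. coeff p k * (R ^\<^sub>m k) $$ (i, j))"

definition residual ::
    "real mat \<Rightarrow> real Matrix.vec \<Rightarrow> (nat \<Rightarrow> real Matrix.vec) \<Rightarrow> nat \<Rightarrow> real Matrix.vec" where
  "residual R f v k = f - R *\<^sub>v v k"

definition gmres_iteration ::
    "real mat \<Rightarrow> real Matrix.vec \<Rightarrow> (nat \<Rightarrow> real Matrix.vec) \<Rightarrow> bool" where
  "gmres_iteration R f v \<longleftrightarrow>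
     (let n = dim_row R; r = residual R f v in
        f \<in> carrier_vec n \<and> (\<forall>k. v k \<in> carrier_vec n) \<and> r 0 \<noteq> 0\<^sub>v n \<and>
        (\<forall>k. \<exists>p. is_arg_min (\<lambda>q. vnorm (mat_poly q R *\<^sub>v r 0))
                             (\<lambda>q. degree q \<le> k \<and> poly q 0 = 1) p \<and>
                  vnorm (r k) = vnorm (mat_poly p R *\<^sub>v r 0)))"

definition asymptotic_linear_rate :: "(nat \<Rightarrow> real Matrix.vec) \<Rightarrow> real \<Rightarrow> bool" where
  "asymptotic_linear_rate r \<theta> \<longleftrightarrow> (\<exists>c. \<forall>k. vnorm (r k) \<le> c * \<theta> ^ k * vnorm (r 0))"

end

theory Submission
  imports Defs
begin

text \<open>
  If \<open>R y = z y\<close> and \<open>(u, v)\<close> is the preimage of \<open>y\<close> under the preconditioner, then \<open>z \<noteq> 1\<close> forces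
  \<open>\<tau> A u + M v = 0\<close>, and testing the second block row with \<open>u\<close> shows that
  \<open>z = ((M u, u) + (M v, v)) / ((L u, u) + (M v, v))\<close>, with \<open>L\<close> the lumped mass matrix. So all
  eigenvalues of \<open>R\<close> are real and lie in \<open>[C\<^sub>1, 1]\<close>. With \<open>c = (1 + C\<^sub>1) / 2\<close>, the polynomial
  \<open>(1 - X / c)\<^sup>k\<close> is admissible in the GMRes minimisation. On a Jordan block with eigenvalue
  \<open>z\<close> the powers of \<open>R - c\<close> have the entries \<open>(k choose d) (z - c)\<^bsup>k - d\<^esup>\<close> on the \<open>d\<close>-th
  superdiagonal, and one summand of the binomial theorem bounds them by
  \<open>((1 - C\<^sub>1) / 2 + C\<^sub>1 / 4)\<^sup>k (4 / C\<^sub>1)\<^sup>d\<close>: the enlargement of the radius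
  \<open>(1 - C\<^sub>1) / 2\<close> by \<open>C\<^sub>1 / 4\<close> absorbs the polynomial growth in \<open>k\<close>. The sum over \<open>d < m\<close> gives the constant.
\<close>

subsection \<open>Euclidean and spectral norms\<close>

lemma vnorm_nonneg [simp]: "0 \<le> vnorm x"
  by (simp add: vnorm_def)

lemma vnorm_zero [simp]: "vnorm (0\<^sub>v n) = 0"
  by (simp add: vnorm_def L2_set_0')

lemma vnorm_eq_0_iff: "x \<in> carrier_vec n \<Longrightarrow> vnorm x = 0 \<longleftrightarrow> x = 0\<^sub>v n"
  by (auto simp: vnorm_def L2_set_eq_0_iff)

lemma vnorm_smult:
  fixes x :: "'a :: real_normed_field Matrix.vec"
  shows "vnorm (c \<cdot>\<^sub>v x) = norm c * vnorm x"
proof -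
  have "vnorm (c \<cdot>\<^sub>v x) = L2_set (\<lambda>i. norm c * norm (vec_index x i)) {..<dim_vec x}"
    unfolding vnorm_def by (rule L2_set_cong) (auto simp: norm_mult)
  then show ?thesis by (simp add: vnorm_def L2_set_right_distrib)
qed

lemma vnorm_append: "vnorm (x @\<^sub>v y) = sqrt ((vnorm x)\<^sup>2 + (vnorm y)\<^sup>2)"
proof -
  let ?f = "\<lambda>i. (norm (vec_index (x @\<^sub>v y) i))\<^sup>2"
  have "(\<Sum>i<dim_vec x + dim_vec y. ?f i) = sum ?f {0..<dim_vec x} + sum ?f {dim_vec x..<dim_vec x + dim_vec y}"
    using sum.atLeastLessThan_concat[of 0 "dim_vec x" "dim_vec x + dim_vec y" ?f]
    by (simp only: lessThan_atLeast0)
  also have "sum ?f {dim_vec x..<dim_vec x + dim_vec y} = (\<Sum>i=0..<dim_vec y. ?f (i + dim_vec x))"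
    using sum.shift_bounds_nat_ivl[of ?f 0 "dim_vec x" "dim_vec y"] by (simp add: add.commute)
  also have "sum ?f {0..<dim_vec x} + \<dots>
      = (\<Sum>i<dim_vec x. (norm (vec_index x i))\<^sup>2) + (\<Sum>i<dim_vec y. (norm (vec_index y i))\<^sup>2)"
    by (intro arg_cong2[of _ _ _ _ plus] sum.cong) auto
  finally show ?thesis
    by (simp add: vnorm_def L2_set_def sum_nonneg)
qed

lemma vnorm_of_real: "vnorm (map_vec complex_of_real x) = vnorm x"
  by (simp add: vnorm_def L2_set_def)

lemma L2_set_norm_sum_le:
  fixes g :: "'b \<Rightarrow> 'c \<Rightarrow> 'a :: real_normed_vector"
  shows "L2_set (\<lambda>i. norm (\<Sum>d\<in>D. g d i)) A \<le> (\<Sum>d\<in>D. L2_set (\<lambda>i. norm (g d i)) A)"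
proof (induction D rule: infinite_finite_induct)
  case (insert d D)
  have "L2_set (\<lambda>i. norm (\<Sum>d\<in>insert d D. g d i)) A
      \<le> L2_set (\<lambda>i. norm (g d i) + norm (\<Sum>d\<in>D. g d i)) A"
    using insert by (intro L2_set_mono) (auto intro: norm_triangle_ineq)
  also have "\<dots> \<le> L2_set (\<lambda>i. norm (g d i)) A + L2_set (\<lambda>i. norm (\<Sum>d\<in>D. g d i)) A"
    by (rule L2_set_triangle_ineq)
  finally show ?case using insert by simp
qed (auto simp: L2_set_0')

text \<open>The squared norms of the two halves of a vector add up, so a bound shared by both
  diagonal blocks carries over with the same constant. This drives the induction over the Jordan
  blocks.\<close>

lemma vnorm_four_block_diag_le:
  fixes A D :: "'a :: real_normed_field mat"
  assumes A: "A \<in> carrier_mat n n" and D: "D \<in> carrier_mat m m" and K: "0 \<le> K"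
    and le: "\<And>x. x \<in> carrier_vec n \<Longrightarrow> vnorm (A *\<^sub>v x) \<le> K * vnorm x"
      "\<And>x. x \<in> carrier_vec m \<Longrightarrow> vnorm (D *\<^sub>v x) \<le> K * vnorm x"
    and z: "z \<in> carrier_vec (n + m)"
  shows "vnorm (four_block_mat A (0\<^sub>m n m) (0\<^sub>m m n) D *\<^sub>v z) \<le> K * vnorm z"
proof -
  define x y where "x = vec_first z n" and "y = vec_last z m"
  have xy: "x \<in> carrier_vec n" "y \<in> carrier_vec m" and z_eq: "z = x @\<^sub>v y"
    using z by (auto simp: x_def y_def)
  have "(vnorm (A *\<^sub>v x))\<^sup>2 + (vnorm (D *\<^sub>v y))\<^sup>2 \<le> (K * vnorm x)\<^sup>2 + (K * vnorm y)\<^sup>2"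
    using le xy by (intro add_mono power_mono) auto
  then have "sqrt ((vnorm (A *\<^sub>v x))\<^sup>2 + (vnorm (D *\<^sub>v y))\<^sup>2) \<le> sqrt (K\<^sup>2 * ((vnorm x)\<^sup>2 + (vnorm y)\<^sup>2))"
    by (simp add: algebra_simps)
  then show ?thesis
    unfolding z_eq mult_mat_vec_split[OF A D xy] vnorm_append using K by (simp add: real_sqrt_mult)
qed

text \<open>Without boundedness the \<open>Sup\<close> in \<open>spectral_norm\<close> would say
  nothing. Every entry of a vector in the unit ball has norm at most 1, so the sum of the norms of
  all matrix entries is a bound.\<close>

lemma bdd_above_spectral_norm:
  fixes A :: "'a :: real_normed_field mat"
  shows "bdd_above {vnorm (A *\<^sub>v x) | x. x \<in> carrier_vec (dim_col A) \<and> vnorm x \<le> 1}"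
proof (rule bdd_aboveI)
  fix y assume "y \<in> {vnorm (A *\<^sub>v x) | x. x \<in> carrier_vec (dim_col A) \<and> vnorm x \<le> 1}"
  then obtain x where y: "y = vnorm (A *\<^sub>v x)" and x: "x \<in> carrier_vec (dim_col A)" "vnorm x \<le> 1"
    by blast
  have x1: "norm (vec_index x j) \<le> 1" if "j < dim_col A" for j
    using member_le_L2_set[of "{..<dim_vec x}" j "\<lambda>j. norm (vec_index x j)"] that x by (auto simp: vnorm_def)
  have "norm (A $$ (i, j) * vec_index x j) \<le> norm (A $$ (i, j))" if "j < dim_col A" for i j
    using mult_left_mono[OF x1[OF that], of "norm (A $$ (i, j))"] by (simp add: norm_mult)
  then have "norm (vec_index (A *\<^sub>v x) i) \<le> (\<Sum>j<dim_col A. norm (A $$ (i, j)))"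
    if "i < dim_row A" for i
    using that x unfolding index_mult_mat_vec[OF that] scalar_prod_def
    by (intro order_trans[OF norm_sum] ) (auto simp: lessThan_atLeast0 intro!: sum_mono)
  then have "(\<Sum>i<dim_row A. norm (vec_index (A *\<^sub>v x) i)) \<le> (\<Sum>i<dim_row A. \<Sum>j<dim_col A. norm (A $$ (i, j)))"
    by (intro sum_mono) auto
  moreover have "y \<le> (\<Sum>i<dim_row A. norm (vec_index (A *\<^sub>v x) i))"
    unfolding y vnorm_def by (rule order_trans[OF L2_set_le_sum_abs]) simp
  ultimately show "y \<le> (\<Sum>i<dim_row A. \<Sum>j<dim_col A. norm (A $$ (i, j)))" by linarith
qed

lemma vnorm_mult_mat_vec_le:
  fixes A :: "'a :: real_normed_field mat"
  assumes x: "x \<in> carrier_vec (dim_col A)"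
  shows "vnorm (A *\<^sub>v x) \<le> spectral_norm A * vnorm x"
proof (cases "vnorm x = 0")
  case True
  then have "x = 0\<^sub>v (dim_col A)" using vnorm_eq_0_iff[OF x] by simp
  moreover have "A *\<^sub>v 0\<^sub>v (dim_col A) = 0\<^sub>v (dim_row A)"
    by (rule eq_vecI) auto
  ultimately show ?thesis by simp
next
  case False
  \<comment> \<open>Scaling to norm 1 makes the vector admissible in the supremum; linearity undoes
    the scaling afterwards.\<close>
  define y where "y = of_real (1 / vnorm x) \<cdot>\<^sub>v x"
  have y: "y \<in> carrier_vec (dim_col A)" "vnorm y \<le> 1"
    using x False by (auto simp: y_def vnorm_smult norm_divide)
  then have "vnorm (A *\<^sub>v y) \<le> spectral_norm A"
    unfolding spectral_norm_def by (intro cSup_upper bdd_above_spectral_norm) blast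
  moreover have "A *\<^sub>v y = of_real (1 / vnorm x) \<cdot>\<^sub>v (A *\<^sub>v x)"
    unfolding y_def by (rule mult_mat_vec) (use x in auto)
  ultimately have "vnorm (A *\<^sub>v x) / vnorm x \<le> spectral_norm A"
    by (simp add: vnorm_smult norm_divide)
  then show ?thesis using False vnorm_nonneg[of x] by (simp add: divide_le_eq split: if_splits)
qed

lemma spectral_norm_nonneg: "0 \<le> spectral_norm (A :: 'a :: real_normed_field mat)"
proof -
  have "vnorm (A *\<^sub>v 0\<^sub>v (dim_col A)) \<le> spectral_norm A"
    unfolding spectral_norm_def by (intro cSup_upper bdd_above_spectral_norm) force
  then show ?thesis using vnorm_nonneg order_trans by blast
qed

section \<open>Inverse matrices and the condition number\<close>

lemma mat_inv_props:
  fixes A :: "'a :: field mat"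
  assumes A: "A \<in> carrier_mat n n" and inv: "invertible_mat A"
  shows "mat_inv A \<in> carrier_mat n n" "A * mat_inv A = 1\<^sub>m n" "mat_inv A * A = 1\<^sub>m n"
proof -
  obtain B where B: "A * B = 1\<^sub>m n" "B * A = 1\<^sub>m (dim_row B)"
    using A inv by (auto simp: invertible_mat_def inverts_mat_def)
  \<comment> \<open>\<open>invertible_mat\<close> fixes the shape of the inverse only through the
    two products.\<close>
  have "dim_col B = n" "dim_row B = n"
    using arg_cong[OF B(1), of dim_col] arg_cong[OF B(2), of dim_col] A by auto
  \<comment> \<open>For units of the matrix ring \<open>mat_inverse\<close> cannot return
    \<open>None\<close>, so \<open>the\<close> in \<open>mat_inv\<close> has a defined
    value.\<close>
  then have "A \<in> Units (ring_mat TYPE('a) n ())"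
    using A B by (auto simp: Units_def ring_mat_def intro!: bexI[of _ B])
  then obtain C where C: "mat_inverse A = Some C"
    using mat_inverse(1)[OF A, of "()"] by (cases "mat_inverse A") auto
  from mat_inverse(2)[OF A C] C
  show "mat_inv A \<in> carrier_mat n n" "A * mat_inv A = 1\<^sub>m n" "mat_inv A * A = 1\<^sub>m n"
    by (auto simp: mat_inv_def)
qed

lemma invertible_mat_if_inj:
  fixes A :: "'a :: field mat"
  assumes A: "A \<in> carrier_mat n n"
    and inj: "\<And>x. x \<in> carrier_vec n \<Longrightarrow> A *\<^sub>v x = 0\<^sub>v n \<Longrightarrow> x = 0\<^sub>v n"
  shows "invertible_mat A"
proof -
  have "Determinant.det A \<noteq> 0" using inj det_0_iff_vec_prod_zero[OF A] by blast
  from det_non_zero_imp_unit[OF A this, of "()"] obtain B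
    where "B \<in> carrier_mat n n" "B * A = 1\<^sub>m n" "A * B = 1\<^sub>m n"
    by (auto simp: Units_def ring_mat_def)
  then show ?thesis using A by (auto simp: invertible_mat_def inverts_mat_def)
qed

text \<open>Apply \<open>A * mat_inv A = 1\<close> to a vector of nonzero norm and estimate the two
  factors separately. Such a vector exists because \<open>0 < n\<close>.\<close>

lemma condition_number_ge_1:
  fixes A :: "'a :: real_normed_field mat"
  assumes A: "A \<in> carrier_mat n n" "invertible_mat A" and n: "0 < n"
  shows "1 \<le> condition_number A"
proof -
  note Ai = mat_inv_props[OF A]
  define x :: "'a Matrix.vec" where "x = unit_vec n 0"
  have x: "x \<in> carrier_vec n" by (simp add: x_def)
  have "vnorm x \<noteq> 0"
    using vnorm_eq_0_iff[OF x] n arg_cong[of x "0\<^sub>v n" "\<lambda>v. vec_index v 0"] by (auto simp: x_def)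
  have "vnorm x = vnorm (A *\<^sub>v (mat_inv A *\<^sub>v x))"
    using A Ai x by (simp flip: assoc_mult_mat_vec)
  also have "\<dots> \<le> spectral_norm A * vnorm (mat_inv A *\<^sub>v x)"
    using A Ai x by (intro vnorm_mult_mat_vec_le) auto
  also have "\<dots> \<le> spectral_norm A * (spectral_norm (mat_inv A) * vnorm x)"
    using A Ai x by (intro mult_left_mono vnorm_mult_mat_vec_le spectral_norm_nonneg) auto
  finally show ?thesis
    using \<open>vnorm x \<noteq> 0\<close> vnorm_nonneg[of x] by (simp add: condition_number_def flip: mult.assoc)
qed

section \<open>Powers of Jordan blocks and Jordan matrices\<close>

lemma binomial_power_le:
  fixes \<rho> \<epsilon> :: real
  assumes "0 \<le> \<rho>" "0 < \<epsilon>"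
  shows "real (k choose d) * \<rho> ^ (k - d) \<le> (\<rho> + \<epsilon>) ^ k * (1 / \<epsilon>) ^ d"
proof (cases "d \<le> k")
  case True
  have "real (k choose d) * \<epsilon> ^ d * \<rho> ^ (k - d) \<le> (\<Sum>i\<le>k. real (k choose i) * \<epsilon> ^ i * \<rho> ^ (k - i))"
    using True assms by (intro member_le_sum) auto
  also have "\<dots> = (\<rho> + \<epsilon>) ^ k" by (simp add: binomial_ring add.commute)
  finally show ?thesis using assms by (simp add: field_simps)
qed (use assms in \<open>auto simp: binomial_eq_0\<close>)

text \<open>A power of a Jordan block is a combination of shifts, one for each superdiagonal. A
  shift does not increase the Euclidean norm, so the triangle inequality leaves only the sum of the
  coefficients.\<close>

lemma vnorm_jordan_block_power_le:
  fixes a :: complex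
  assumes a: "norm a \<le> \<rho>" and \<epsilon>: "0 < \<epsilon>" and nm: "n \<le> m" and x: "x \<in> carrier_vec n"
  shows "vnorm (jordan_block n a ^\<^sub>m k *\<^sub>v x) \<le> (\<rho> + \<epsilon>) ^ k * (\<Sum>d<m. (1 / \<epsilon>) ^ d) * vnorm x"
proof -
  have \<rho>: "0 \<le> \<rho>" using a norm_ge_zero order_trans by blast
  \<comment> \<open>\<open>S d\<close> is \<open>x\<close> shifted by \<open>d\<close> places and
    filled up with zeros.\<close>
  define S where "S d i = (if i + d < n then vec_index x (i + d) else 0)" for d i
  have "vec_index (jordan_block n a ^\<^sub>m k *\<^sub>v x) i = (\<Sum>d<n. of_nat (k choose d) * a ^ (k - d) * S d i)"
    if "i < n" for i
  proof -
    have "vec_index (jordan_block n a ^\<^sub>m k *\<^sub>v x) i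
        = (\<Sum>j<n. (if i \<le> j then of_nat (k choose (j - i)) * a ^ (k + i - j) else 0) * vec_index x j)"
      using that x by (simp add: jordan_block_pow scalar_prod_def lessThan_atLeast0)
    also have "\<dots> = (\<Sum>j\<in>{i..<n}. of_nat (k choose (j - i)) * a ^ (k + i - j) * vec_index x j)"
      by (rule sum.mono_neutral_cong_right) auto
    \<comment> \<open>The new index \<open>d = j - i\<close> numbers the superdiagonals. For
      \<open>d > k\<close> the truncated exponent is 0, and the binomial coefficient
      vanishes.\<close>
    also have "\<dots> = (\<Sum>d<n - i. of_nat (k choose d) * a ^ (k - d) * vec_index x (i + d))"
      by (rule sum.reindex_bij_witness[where i = "\<lambda>d. i + d" and j = "\<lambda>j. j - i"]) auto
    also have "\<dots> = (\<Sum>d<n. of_nat (k choose d) * a ^ (k - d) * S d i)"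
      by (rule sum.mono_neutral_cong_left) (auto simp: S_def)
    finally show ?thesis .
  qed
  moreover have "dim_vec (jordan_block n a ^\<^sub>m k *\<^sub>v x) = n" by simp
  ultimately have "vnorm (jordan_block n a ^\<^sub>m k *\<^sub>v x)
      = L2_set (\<lambda>i. norm (\<Sum>d<n. of_nat (k choose d) * a ^ (k - d) * S d i)) {..<n}"
    unfolding vnorm_def by (intro L2_set_cong) auto
  also have "\<dots> \<le> (\<Sum>d<n. L2_set (\<lambda>i. norm (of_nat (k choose d) * a ^ (k - d) * S d i)) {..<n})"
    by (rule L2_set_norm_sum_le)
  also have "\<dots> = (\<Sum>d<n. real (k choose d) * norm a ^ (k - d) * L2_set (\<lambda>i. norm (S d i)) {..<n})"
    by (simp add: norm_mult norm_power L2_set_right_distrib)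
  also have "\<dots> \<le> (\<Sum>d<n. (\<rho> + \<epsilon>) ^ k * (1 / \<epsilon>) ^ d * vnorm x)"
  proof (intro sum_mono, rule mult_mono)
    fix d
    have "real (k choose d) * norm a ^ (k - d) \<le> real (k choose d) * \<rho> ^ (k - d)"
      using a by (intro mult_left_mono power_mono) auto
    then show "real (k choose d) * norm a ^ (k - d) \<le> (\<rho> + \<epsilon>) ^ k * (1 / \<epsilon>) ^ d"
      using binomial_power_le[OF \<rho> \<epsilon>, of k d] by linarith
    \<comment> \<open>The nonzero entries of \<open>S d\<close> are entries of \<open>x\<close> at
      distinct positions, so their squares form part of the sum for \<open>x\<close>.\<close>
    have "(\<Sum>i<n. (norm (S d i))\<^sup>2) = (\<Sum>i\<in>{i. i + d < n}. (norm (vec_index x (i + d)))\<^sup>2)"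
      by (rule sum.mono_neutral_cong_right) (auto simp: S_def)
    also have "\<dots> = (\<Sum>j\<in>(\<lambda>i. i + d) ` {i. i + d < n}. (norm (vec_index x j))\<^sup>2)"
      by (subst sum.reindex) (auto intro: inj_onI)
    also have "\<dots> \<le> (\<Sum>j<n. (norm (vec_index x j))\<^sup>2)"
      by (rule sum_mono2) auto
    finally show "L2_set (\<lambda>i. norm (S d i)) {..<n} \<le> vnorm x"
      using x by (auto simp: vnorm_def L2_set_def)
  qed (use \<rho> \<epsilon> in auto)
  also have "\<dots> = (\<rho> + \<epsilon>) ^ k * (\<Sum>d<n. (1 / \<epsilon>) ^ d) * vnorm x"
    by (simp add: sum_distrib_left sum_distrib_right mult_ac)
  \<comment> \<open>With \<open>m\<close> in place of the block size \<open>n\<close>, one constant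
    serves all blocks.\<close>
  also have "\<dots> \<le> (\<rho> + \<epsilon>) ^ k * (\<Sum>d<m. (1 / \<epsilon>) ^ d) * vnorm x"
    using nm \<rho> \<epsilon> by (intro mult_right_mono mult_left_mono sum_mono2) auto
  finally show ?thesis .
qed

text \<open>Powers of a block diagonal matrix are formed block by block, so the number of blocks
  does not enter the constant.\<close>

lemma vnorm_jordan_matrix_power_le:
  fixes n_as :: "(nat \<times> complex) list"
  assumes "\<And>n a. (n, a) \<in> set n_as \<Longrightarrow> n \<le> m \<and> norm a \<le> \<rho>"
    and \<rho>: "0 \<le> \<rho>" and \<epsilon>: "0 < \<epsilon>" and "x \<in> carrier_vec (sum_list (map fst n_as))"
  shows "vnorm (jordan_matrix n_as ^\<^sub>m k *\<^sub>v x) \<le> (\<rho> + \<epsilon>) ^ k * (\<Sum>d<m. (1 / \<epsilon>) ^ d) * vnorm x"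
  using assms(1,4)
proof (induction n_as arbitrary: x)
  case Nil
  then have "vnorm (jordan_matrix [] ^\<^sub>m k *\<^sub>v x) = 0" "vnorm x = 0"
    by (simp_all add: vnorm_def)
  then show ?case by simp
next
  case (Cons na n_as)
  obtain n a where na: "na = (n, a)" by force
  define l where "l = sum_list (map fst n_as)"
  have J: "jordan_matrix n_as \<in> carrier_mat l l" by (simp add: l_def)
  have x: "x \<in> carrier_vec (n + l)" using Cons.prems(2) by (simp add: na l_def)
  show ?case
    unfolding na jordan_matrix_Cons l_def[symmetric] pow_four_block_mat[OF jordan_block_carrier J]
  proof (rule vnorm_four_block_diag_le[OF _ _ _ _ _ x])
    show "0 \<le> (\<rho> + \<epsilon>) ^ k * (\<Sum>d<m. (1 / \<epsilon>) ^ d)"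
      using \<rho> \<epsilon> by (intro mult_nonneg_nonneg sum_nonneg) auto
    show "vnorm (jordan_block n a ^\<^sub>m k *\<^sub>v y) \<le> (\<rho> + \<epsilon>) ^ k * (\<Sum>d<m. (1 / \<epsilon>) ^ d) * vnorm y"
      if "y \<in> carrier_vec n" for y
      using Cons.prems(1)[of n a] na \<epsilon> that by (intro vnorm_jordan_block_power_le) auto
    show "vnorm (jordan_matrix n_as ^\<^sub>m k *\<^sub>v y) \<le> (\<rho> + \<epsilon>) ^ k * (\<Sum>d<m. (1 / \<epsilon>) ^ d) * vnorm y"
      if "y \<in> carrier_vec l" for y
      using Cons.prems(1) that by (intro Cons.IH) (auto simp: l_def)
  qed (use J in auto)
qed

subsection \<open>Polynomials of a matrix and the Jordan form\<close>

lemma pow_smult_mat: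
  fixes A :: "'a :: comm_semiring_1 mat"
  assumes A: "A \<in> carrier_mat n n"
  shows "(c \<cdot>\<^sub>m A) ^\<^sub>m k = c ^ k \<cdot>\<^sub>m (A ^\<^sub>m k)"
proof (induction k)
  case 0
  show ?case by (rule eq_matI) auto
next
  case (Suc k)
  have Ak: "A ^\<^sub>m k \<in> carrier_mat n n" using A by simp
  have "(c \<cdot>\<^sub>m A) ^\<^sub>m Suc k = c ^ k \<cdot>\<^sub>m (A ^\<^sub>m k) * (c \<cdot>\<^sub>m A)" by (simp add: Suc)
  also have "\<dots> = c ^ k \<cdot>\<^sub>m (c \<cdot>\<^sub>m (A ^\<^sub>m k * A))"
    using A Ak by (simp add: mult_smult_distrib[OF Ak A] mult_smult_assoc_mat[of "A ^\<^sub>m k" n n "c \<cdot>\<^sub>m A" n])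
  also have "\<dots> = c ^ Suc k \<cdot>\<^sub>m (A ^\<^sub>m Suc k)"
    by (rule eq_matI) (auto simp: mult_ac)
  finally show ?case .
qed

lemma smult_mat_mult_vec:
  fixes A :: "'a :: comm_semiring_1 mat"
  assumes "v \<in> carrier_vec (dim_col A)"
  shows "(c \<cdot>\<^sub>m A) *\<^sub>v v = c \<cdot>\<^sub>v (A *\<^sub>v v)"
  using assms by (intro eq_vecI) (auto simp: scalar_prod_def sum_distrib_left mult.assoc intro!: sum.cong)

lemma mat_poly_carrier [simp]: "R \<in> carrier_mat n n \<Longrightarrow> mat_poly p R \<in> carrier_mat n n"
  by (auto simp: mat_poly_def)

text \<open>Padding with zero coefficients puts polynomials of different degrees on a common index
  range.\<close>

lemma mat_poly_index:
  assumes R: "R \<in> carrier_mat n n" and ij: "i < n" "j < n" and K: "degree p \<le> K"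
  shows "mat_poly p R $$ (i, j) = (\<Sum>k\<le>K. coeff p k * (R ^\<^sub>m k) $$ (i, j))"
proof -
  have "(\<Sum>k\<le>degree p. coeff p k * (R ^\<^sub>m k) $$ (i, j)) = (\<Sum>k\<le>K. coeff p k * (R ^\<^sub>m k) $$ (i, j))"
    using K by (intro sum.mono_neutral_left) (auto simp: coeff_eq_0)
  then show ?thesis using R ij by (auto simp: mat_poly_def)
qed

text \<open>Evaluation at \<open>R\<close> is multiplicative; one linear factor at a time is enough
  for the powers of \<open>1 - X / c\<close>.\<close>

lemma mat_poly_linear_mult:
  assumes R: "R \<in> carrier_mat n n"
  shows "mat_poly ([:\<alpha>, \<beta>:] * p) R = mat_poly p R * (\<alpha> \<cdot>\<^sub>m 1\<^sub>m n + \<beta> \<cdot>\<^sub>m R)"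
proof (rule eq_matI)
  fix i j assume "i < dim_row (mat_poly p R * (\<alpha> \<cdot>\<^sub>m 1\<^sub>m n + \<beta> \<cdot>\<^sub>m R))"
    "j < dim_col (mat_poly p R * (\<alpha> \<cdot>\<^sub>m 1\<^sub>m n + \<beta> \<cdot>\<^sub>m R))"
  then have ij: "i < n" "j < n" using R mat_poly_carrier[OF R, of p] by auto
  \<comment> \<open>The product can have degree below \<open>Suc D\<close>, for example if
    \<open>\<beta> = 0\<close>, so all sums run up to this common bound.\<close>
  define D where "D = degree p"
  have "degree ([:\<alpha>, \<beta>:] * p) \<le> Suc D"
    unfolding D_def by (rule order_trans[OF degree_mult_le]) simp
  then have "mat_poly ([:\<alpha>, \<beta>:] * p) R $$ (i, j)
      = (\<Sum>k\<le>Suc D. coeff ([:\<alpha>, \<beta>:] * p) k * (R ^\<^sub>m k) $$ (i, j))"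
    by (rule mat_poly_index[OF R ij])
  also have "\<dots> = (\<Sum>k\<le>Suc D. \<alpha> * (coeff p k * (R ^\<^sub>m k) $$ (i, j)))
      + (\<Sum>k\<le>Suc D. \<beta> * (coeff (pCons 0 p) k * (R ^\<^sub>m k) $$ (i, j)))"
  proof -
    have "coeff ([:\<alpha>, \<beta>:] * p) k = \<alpha> * coeff p k + \<beta> * coeff (pCons 0 p) k" for k
      by (cases k) auto
    then show ?thesis by (simp add: algebra_simps sum.distrib del: sum.atMost_Suc pow_mat.simps)
  qed
  also have "(\<Sum>k\<le>Suc D. \<alpha> * (coeff p k * (R ^\<^sub>m k) $$ (i, j))) = \<alpha> * mat_poly p R $$ (i, j)"
    unfolding sum_distrib_left[symmetric]
    by (subst mat_poly_index[OF R ij, of p "Suc D"]) (simp_all add: D_def)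
  \<comment> \<open>The coefficient of \<open>pCons 0 p\<close> at 0 vanishes; shifting the index
    moves one factor \<open>R\<close> into the power.\<close>
  also have "(\<Sum>k\<le>Suc D. \<beta> * (coeff (pCons 0 p) k * (R ^\<^sub>m k) $$ (i, j)))
      = \<beta> * (\<Sum>k\<le>D. coeff p k * (R ^\<^sub>m Suc k) $$ (i, j))"
    by (simp only: sum.atMost_Suc_shift) (simp add: sum_distrib_left)
  also have "(\<Sum>k\<le>D. coeff p k * (R ^\<^sub>m Suc k) $$ (i, j))
      = (\<Sum>k\<le>D. \<Sum>l<n. coeff p k * (R ^\<^sub>m k) $$ (i, l) * R $$ (l, j))"
    using R ij by (auto simp: scalar_prod_def lessThan_atLeast0 sum_distrib_left mult.assoc intro!: sum.cong)
  also have "\<dots> = (\<Sum>l<n. mat_poly p R $$ (i, l) * R $$ (l, j))"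
    using ij by (subst sum.swap) (auto simp: mat_poly_index[OF R, of _ _ p D] D_def sum_distrib_right intro!: sum.cong)
  \<comment> \<open>Writing the multiple of the identity as a Kronecker delta lets both sums merge
    into one matrix product.\<close>
  also have "\<alpha> * mat_poly p R $$ (i, j) = (\<Sum>l<n. mat_poly p R $$ (i, l) * (\<alpha> * (if l = j then 1 else 0)))"
    using ij by (simp add: sum.delta if_distrib cong: if_cong)
  also have "(\<Sum>l<n. mat_poly p R $$ (i, l) * (\<alpha> * (if l = j then 1 else 0)))
      + \<beta> * (\<Sum>l<n. mat_poly p R $$ (i, l) * R $$ (l, j))
      = (\<Sum>l<n. mat_poly p R $$ (i, l) * (\<alpha> * (if l = j then 1 else 0) + \<beta> * R $$ (l, j)))"
    by (simp add: sum_distrib_left sum.distrib distrib_left mult.left_commute)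
  also have "\<dots> = (mat_poly p R * (\<alpha> \<cdot>\<^sub>m 1\<^sub>m n + \<beta> \<cdot>\<^sub>m R)) $$ (i, j)"
    using R ij mat_poly_carrier[OF R, of p, THEN carrier_matD(1)] mat_poly_carrier[OF R, of p, THEN carrier_matD(2)]
    by (auto simp: scalar_prod_def lessThan_atLeast0 intro!: sum.cong)
  finally show "mat_poly ([:\<alpha>, \<beta>:] * p) R $$ (i, j) = \<dots>" .
qed (use R in \<open>auto simp: mat_poly_def\<close>)

lemma mat_poly_linear_power:
  assumes R: "R \<in> carrier_mat n n"
  shows "mat_poly ([:\<alpha>, \<beta>:] ^ k) R = (\<alpha> \<cdot>\<^sub>m 1\<^sub>m n + \<beta> \<cdot>\<^sub>m R) ^\<^sub>m k"
proof (induction k)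
  case 0
  show ?case using R by (intro eq_matI) (auto simp: mat_poly_def)
next
  case (Suc k)
  then show ?case by (simp only: power_Suc mat_poly_linear_mult[OF R] pow_mat.simps)
qed

text \<open>Subtracting \<open>c\<close> from a matrix therefore keeps the block sizes and the
  transformation and only moves the eigenvalues.\<close>

lemma jordan_matrix_add_smult_one:
  fixes n_as :: "(nat \<times> 'a :: comm_ring_1) list"
  shows "jordan_matrix (map (\<lambda>(n, a). (n, a + c)) n_as)
    = jordan_matrix n_as + c \<cdot>\<^sub>m 1\<^sub>m (sum_list (map fst n_as))"
proof (induction n_as)
  case Nil
  show ?case by (rule eq_matI) auto
next
  case (Cons na n_as)
  obtain n a where na: "na = (n, a)" by force
  have fst: "map fst (map (\<lambda>(n, a). (n, a + c)) n_as) = map fst n_as"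
    by (induction n_as) auto
  define l where "l = sum_list (map fst n_as)"
  have J: "jordan_matrix n_as \<in> carrier_mat l l" by (simp add: l_def)
  show ?case
    unfolding na list.map prod.case jordan_matrix_Cons fst Cons.IH l_def[symmetric]
    by (rule eq_matI) (use J in \<open>auto simp: l_def[symmetric]\<close>)
qed

section \<open>Transformations to Jordan canonical form\<close>

lemma jordan_transformation_similar:
  assumes R: "R \<in> carrier_mat n n" and jt: "jordan_transformation R V n_as"
  shows "similar_mat_wit (map_mat complex_of_real R) (jordan_matrix n_as) V (mat_inv V)"
proof -
  let ?R = "map_mat complex_of_real R"
  have R': "?R \<in> carrier_mat n n" using R by simp
  have V: "V \<in> carrier_mat n n" "invertible_mat V" and J: "mat_inv V * ?R * V = jordan_matrix n_as"
    using jt R by (auto simp: jordan_transformation_def)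
  note Vi = mat_inv_props[OF V]
  have "V * jordan_matrix n_as * mat_inv V = (V * mat_inv V) * ?R * (V * mat_inv V)"
    unfolding J[symmetric] using V(1) R' Vi(1)
    by (simp add: assoc_mult_mat[of _ n n _ n _ n])
  also have "\<dots> = ?R" using R' by (simp add: Vi)
  finally show ?thesis
    using V R' Vi by (intro similar_mat_witI[of _ _ n]) (auto simp flip: J)
qed

text \<open>The characteristic polynomial splits over the complex numbers. The asymptotic rate
  mentions no transformation, so its constant has to come from one that is known to exist.\<close>

lemma jordan_transformation_exists:
  assumes R: "R \<in> carrier_mat n n"
  obtains V n_as where "jordan_transformation R V n_as"
proof -
  let ?R = "map_mat complex_of_real R"
  have R': "?R \<in> carrier_mat n n" using R by simp
  obtain n_as where jnf: "jordan_nf ?R n_as"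
    using char_poly_factorized[OF R'] jordan_nf_exists[OF R'] by blast
  then obtain P Q where w: "similar_mat_wit ?R (jordan_matrix n_as) P Q"
    by (auto simp: jordan_nf_def similar_mat_def)
  note PQ = similar_mat_witD2[OF R' w]
  have inv: "invertible_mat P"
    using PQ(1,2,6,7) by (auto simp: invertible_mat_def inverts_mat_def)
  note Pi = mat_inv_props[OF PQ(6) inv]
  \<comment> \<open>Uniqueness of inverses identifies the similarity witness \<open>Q\<close> with
    \<open>mat_inv P\<close>.\<close>
  have "mat_inv P = mat_inv P * (P * Q)" unfolding PQ(1) using Pi by simp
  also have "\<dots> = Q"
    unfolding assoc_mult_mat[OF Pi(1) PQ(6,7), symmetric] Pi(3) using PQ(7) by simp
  finally have "mat_inv P * ?R * P = Q * (P * jordan_matrix n_as * Q) * P"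
    unfolding PQ(3) by simp
  also have "\<dots> = (Q * P) * jordan_matrix n_as * (Q * P)"
    using PQ(5-7) by (simp add: assoc_mult_mat[of _ n n _ n _ n])
  also have "\<dots> = jordan_matrix n_as" unfolding PQ(2) left_mult_one_mat[OF PQ(5)] right_mult_one_mat[OF PQ(5)] ..
  finally have "jordan_transformation R P n_as"
    using jnf R PQ(6) inv by (simp add: jordan_transformation_def jordan_nf_def)
  then show thesis by (rule that)
qed

text \<open>The characteristic polynomial is the product of the factors \<open>(X - a) ^ l\<close>,
  so \<open>a\<close> is a root because empty blocks are excluded.\<close>

lemma jordan_transformation_eigenvalue:
  assumes R: "R \<in> carrier_mat n n" and jt: "jordan_transformation R V n_as" and a: "(l, a) \<in> set n_as"
  shows "eigenvalue (map_mat complex_of_real R) a"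
proof -
  have "jordan_nf (map_mat complex_of_real R) n_as"
    using jordan_transformation_similar[OF R jt] jt
    by (auto simp: jordan_nf_def similar_mat_def jordan_transformation_def)
  moreover have "l \<noteq> 0" using a jt by (force simp: jordan_transformation_def)
  ultimately have "poly (char_poly (map_mat complex_of_real R)) a = 0"
    using a by (subst jordan_nf_char_poly) (force simp: poly_prod_list prod_list_zero_iff)+
  then show ?thesis using R by (subst eigenvalue_root_char_poly[of _ n]) auto
qed

lemma jordan_transformation_size:
  assumes R: "R \<in> carrier_mat n n" and jt: "jordan_transformation R V n_as"
  shows "sum_list (map fst n_as) = n"
  using similar_mat_witD2(5)[OF _ jordan_transformation_similar[OF R jt], of n n] R by auto

text \<open>Every block has size at least 1. This keeps the argument of the square root in
  \<open>C_R\<close> nonnegative.\<close>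

lemma num_blocks_le:
  assumes R: "R \<in> carrier_mat n n" and jt: "jordan_transformation R V n_as"
  shows "num_blocks n_as \<le> n"
proof -
  have "length n_as \<le> sum_list (map fst n_as)" if "0 \<notin> fst ` set n_as"
    using that by (induction n_as) auto
  then show ?thesis
    using jt jordan_transformation_size[OF assms] by (simp add: num_blocks_def jordan_transformation_def)
qed

text \<open>The matrix \<open>1 - R / c\<close> is \<open>- 1 / c\<close> times
  \<open>R - c\<close>, and the Jordan form of \<open>R - c\<close> has the eigenvalues
  \<open>z - c\<close>. The condition number is the price of passing to Jordan coordinates and
  back.\<close>

lemma vnorm_mat_poly_linear_power_le:
  assumes R: "R \<in> carrier_mat n n" and jt: "jordan_transformation R V n_as" and x: "x \<in> carrier_vec n"
    and c: "0 < c" and \<rho>: "0 \<le> \<rho>" and \<epsilon>: "0 < \<epsilon>"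
    and ev: "\<And>z. eigenvalue (map_mat complex_of_real R) z \<Longrightarrow> norm (z - complex_of_real c) \<le> \<rho>"
  shows "vnorm (mat_poly ([:1, - 1 / c:] ^ k) R *\<^sub>v x)
    \<le> condition_number V * (\<Sum>d<max_block_size n_as. (1 / \<epsilon>) ^ d) * ((\<rho> + \<epsilon>) / c) ^ k * vnorm x"
proof -
  let ?R = "map_mat complex_of_real R" and ?x = "map_vec complex_of_real x"
  define s where "s = complex_of_real (- 1 / c)"
  define n_as' where "n_as' = map (\<lambda>(n, a). (n, a + (- complex_of_real c))) n_as"
  define J' where "J' = jordan_matrix n_as'"
  define P where "P = 1 \<cdot>\<^sub>m 1\<^sub>m n + (- 1 / c) \<cdot>\<^sub>m R"
  define S where "S = (\<Sum>d<max_block_size n_as. (1 / \<epsilon>) ^ d)"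
  have S: "0 \<le> S" unfolding S_def using \<epsilon> by (intro sum_nonneg) auto
  have R': "?R \<in> carrier_mat n n" using R by simp
  note w = similar_mat_witD2[OF R' jordan_transformation_similar[OF R jt]]
  note size = jordan_transformation_size[OF R jt]
  have J': "J' \<in> carrier_mat n n"
    unfolding J'_def n_as'_def jordan_matrix_add_smult_one size using w by simp
  have P: "P \<in> carrier_mat n n" using R by (simp add: P_def)
  have sJ': "s \<cdot>\<^sub>m J' = 1\<^sub>m n + s \<cdot>\<^sub>m jordan_matrix n_as"
    unfolding J'_def n_as'_def jordan_matrix_add_smult_one size
    by (rule eq_matI) (use w c in \<open>auto simp: s_def field_simps\<close>)
  have "V * (s \<cdot>\<^sub>m J') * mat_inv V = V * mat_inv V + V * (s \<cdot>\<^sub>m jordan_matrix n_as) * mat_inv V"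
    unfolding sJ' using w(5-7)
    by (simp add: mult_add_distrib_mat[of _ n n _ n] add_mult_distrib_mat[of _ n n _ _ n])
  also have "V * (s \<cdot>\<^sub>m jordan_matrix n_as) * mat_inv V = s \<cdot>\<^sub>m (V * jordan_matrix n_as * mat_inv V)"
    using w(5-7) by (simp add: mult_smult_distrib[of _ n n _ n] mult_smult_assoc_mat[of _ n n _ n])
  also have "V * mat_inv V + \<dots> = 1\<^sub>m n + s \<cdot>\<^sub>m ?R" using w by simp
  also have "\<dots> = map_mat complex_of_real P"
    unfolding P_def by (rule eq_matI) (use R in \<open>auto simp: s_def\<close>)
  finally have "similar_mat_wit (map_mat complex_of_real P) (s \<cdot>\<^sub>m J') V (mat_inv V)"
    using P J' w by (intro similar_mat_witI[of _ _ n]) auto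
  \<comment> \<open>Inner factors \<open>mat_inv V * V\<close> cancel in the power, so the condition
    number enters once and not \<open>k\<close> times.\<close>
  from similar_mat_wit_pow_id[OF this]
  have pow: "map_mat complex_of_real (P ^\<^sub>m k) = V * (s ^ k \<cdot>\<^sub>m J' ^\<^sub>m k) * mat_inv V"
    unfolding of_real_hom.mat_hom_pow[OF P] pow_smult_mat[OF J'] .
  define y where "y = mat_inv V *\<^sub>v ?x"
  have y: "y \<in> carrier_vec n" unfolding y_def using w x by simp
  have Jy: "J' ^\<^sub>m k *\<^sub>v y \<in> carrier_vec n" using pow_carrier_mat[OF J'] y by (rule mult_mat_vec_carrier)
  have "map_vec complex_of_real (mat_poly ([:1, - 1 / c:] ^ k) R *\<^sub>v x)
      = V * (s ^ k \<cdot>\<^sub>m J' ^\<^sub>m k) * mat_inv V *\<^sub>v ?x"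
    unfolding mat_poly_linear_power[OF R] P_def[symmetric] pow[symmetric]
    by (rule of_real_hom.mult_mat_vec_hom) (use P x in auto)
  also have "\<dots> = V *\<^sub>v (s ^ k \<cdot>\<^sub>v (J' ^\<^sub>m k *\<^sub>v y))"
  proof -
    have 1: "s ^ k \<cdot>\<^sub>m J' ^\<^sub>m k \<in> carrier_mat n n" using pow_carrier_mat[OF J', of k] by auto
    have 2: "y \<in> carrier_vec (dim_col (J' ^\<^sub>m k))" using pow_carrier_mat[OF J', of k] y by auto
    have 3: "V * (s ^ k \<cdot>\<^sub>m J' ^\<^sub>m k) \<in> carrier_mat n n" using w(6) 1 by (rule mult_carrier_mat)
    have 4: "?x \<in> carrier_vec n" using x by simp
    show ?thesis
      unfolding assoc_mult_mat_vec[OF 3 w(7) 4] y_def[symmetric] assoc_mult_mat_vec[OF w(6) 1 y]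
        smult_mat_mult_vec[OF 2] ..
  qed
  \<comment> \<open>Embedding real vectors into complex ones preserves the norm, so the complex
    Jordan form yields a real estimate.\<close>
  finally have "vnorm (mat_poly ([:1, - 1 / c:] ^ k) R *\<^sub>v x) = vnorm (V *\<^sub>v (s ^ k \<cdot>\<^sub>v (J' ^\<^sub>m k *\<^sub>v y)))"
    using vnorm_of_real[of "mat_poly ([:1, - 1 / c:] ^ k) R *\<^sub>v x"] by simp
  also have "\<dots> \<le> spectral_norm V * ((1 / c) ^ k * vnorm (J' ^\<^sub>m k *\<^sub>v y))"
    using vnorm_mult_mat_vec_le[of "s ^ k \<cdot>\<^sub>v (J' ^\<^sub>m k *\<^sub>v y)" V] w Jy c
    by (simp add: vnorm_smult norm_power s_def norm_divide)
  also have "\<dots> \<le> spectral_norm V * ((1 / c) ^ k * ((\<rho> + \<epsilon>) ^ k * S * (spectral_norm (mat_inv V) * vnorm x)))"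
  proof (intro mult_left_mono spectral_norm_nonneg)
    have "fst (case z of (l, a) \<Rightarrow> (l, a + (- complex_of_real c))) = fst z" for z :: "nat \<times> complex"
      by (cases z) auto
    then have fst: "map fst n_as' = map fst n_as" by (simp add: n_as'_def o_def)
    have "l \<le> max_block_size n_as \<and> norm a \<le> \<rho>" if "(l, a) \<in> set n_as'" for l a
    proof -
      obtain a' where a': "(l, a') \<in> set n_as" "a = a' - complex_of_real c"
        using \<open>(l, a) \<in> set n_as'\<close> by (auto simp: n_as'_def)
      have "l \<le> Max (fst ` set n_as)" using a'(1) by (intro Max_ge) force+
      then show ?thesis
        using ev[OF jordan_transformation_eigenvalue[OF R jt a'(1)]] a'(2) by (simp add: max_block_size_def)
    qed
    then have "vnorm (J' ^\<^sub>m k *\<^sub>v y) \<le> (\<rho> + \<epsilon>) ^ k * S * vnorm y"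
      unfolding J'_def S_def using \<rho> \<epsilon> y size
      by (intro vnorm_jordan_matrix_power_le) (auto simp: fst)
    also have "vnorm y \<le> spectral_norm (mat_inv V) * vnorm x"
      unfolding y_def vnorm_of_real[symmetric] by (rule vnorm_mult_mat_vec_le) (use w x in auto)
    finally show "vnorm (J' ^\<^sub>m k *\<^sub>v y) \<le> (\<rho> + \<epsilon>) ^ k * S * (spectral_norm (mat_inv V) * vnorm x)"
      using \<rho> \<epsilon> S by (simp add: mult_left_mono)
  qed (use c in auto)
  finally show ?thesis
    unfolding S_def condition_number_def by (simp add: mult_ac power_divide)
qed

lemma gmres_residual_le:
  assumes "gmres_iteration R f v" "degree q \<le> k" "poly q 0 = 1"
  shows "vnorm (residual R f v k) \<le> vnorm (mat_poly q R *\<^sub>v residual R f v 0)"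
  using assms unfolding gmres_iteration_def Let_def is_arg_min_linorder by metis

subsection \<open>Spectrum of the preconditioned matrix\<close>

lemma zero_vec_append: "0\<^sub>v n @\<^sub>v 0\<^sub>v m = 0\<^sub>v (n + m)"
  by (rule eq_vecI) auto

text \<open>Exchange the two sums and use symmetry; conjugation fixes the real entries of
  \<open>G\<close>. This links the coupling terms of the two block rows.\<close>

lemma hermitian_form_adjoint:
  assumes G: "G \<in> carrier_mat N N" and sym: "\<And>i j. i < N \<Longrightarrow> j < N \<Longrightarrow> G $$ (i, j) = G $$ (j, i)"
    and u: "u \<in> carrier_vec N" and v: "v \<in> carrier_vec N"
  shows "scalar_prod (map_mat complex_of_real G *\<^sub>v v) (conjugate u)
    = cnj (scalar_prod (map_mat complex_of_real G *\<^sub>v u) (conjugate v))"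
proof -
  have form: "scalar_prod (map_mat complex_of_real G *\<^sub>v y) (conjugate x)
      = (\<Sum>i<N. \<Sum>j<N. complex_of_real (G $$ (i, j)) * vec_index y j * cnj (vec_index x i))"
    if "x \<in> carrier_vec N" "y \<in> carrier_vec N" for x y
    using that G by (auto simp: scalar_prod_def lessThan_atLeast0 sum_distrib_right intro!: sum.cong)
  have "(\<Sum>i<N. \<Sum>j<N. complex_of_real (G $$ (i, j)) * vec_index v j * cnj (vec_index u i))
      = (\<Sum>j<N. \<Sum>i<N. complex_of_real (G $$ (i, j)) * vec_index v j * cnj (vec_index u i))"
    by (rule sum.swap)
  also have "\<dots> = (\<Sum>j<N. \<Sum>i<N. cnj (complex_of_real (G $$ (j, i)) * vec_index u i * cnj (vec_index v j)))"
    using sym by (intro sum.cong) (auto simp: mult_ac)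
  finally show ?thesis by (simp add: form u v)
qed

lemma hermitian_form_real:
  assumes G: "G \<in> carrier_mat N N" and sym: "\<And>i j. i < N \<Longrightarrow> j < N \<Longrightarrow> G $$ (i, j) = G $$ (j, i)"
    and u: "u \<in> carrier_vec N"
  shows "scalar_prod (map_mat complex_of_real G *\<^sub>v u) (conjugate u)
    = complex_of_real (scalar_prod (G *\<^sub>v map_vec Re u) (map_vec Re u)
        + scalar_prod (G *\<^sub>v map_vec Im u) (map_vec Im u))" (is "?z = complex_of_real ?r")
proof (rule complex_eqI)
  \<comment> \<open>With both arguments equal to \<open>u\<close>, the form equals its own
    conjugate.\<close>
  show "Im ?z = Im (complex_of_real ?r)"
    using arg_cong[OF hermitian_form_adjoint[OF G sym u u], of Im] by simp
  show "Re ?z = Re (complex_of_real ?r)"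
    using G u by (simp add: scalar_prod_def sum_distrib_right sum.distrib algebra_simps)
qed

text \<open>A nonzero complex vector has a nonzero real or imaginary part, and the other part
  contributes at least 0.\<close>

lemma positive_hermitian_form:
  assumes G: "G \<in> carrier_mat N N"
    and pos: "\<And>w. w \<in> carrier_vec N \<Longrightarrow> w \<noteq> 0\<^sub>v N \<Longrightarrow> 0 < scalar_prod (G *\<^sub>v w) w"
    and u: "u \<in> carrier_vec N" "u \<noteq> 0\<^sub>v N"
  shows "0 < scalar_prod (G *\<^sub>v map_vec Re u) (map_vec Re u)
        + scalar_prod (G *\<^sub>v map_vec Im u) (map_vec Im u)"
proof -
  have nonneg: "0 \<le> scalar_prod (G *\<^sub>v w) w" if "w \<in> carrier_vec N" for w
    using pos[OF that] G by (cases "w = 0\<^sub>v N") (auto simp: scalar_prod_def less_imp_le)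
  have "map_vec Re u \<noteq> 0\<^sub>v N \<or> map_vec Im u \<noteq> 0\<^sub>v N"
  proof (rule ccontr)
    assume "\<not> ?thesis"
    then have "Re (vec_index u i) = 0 \<and> Im (vec_index u i) = 0" if "i < N" for i
      using that u(1) by (metis carrier_vecD index_map_vec(1) index_zero_vec(1))
    then have "u = 0\<^sub>v N" using u(1) by (intro eq_vecI) (auto simp: complex_eq_iff)
    with u show False by blast
  qed
  then show ?thesis
    using pos[of "map_vec Re u"] pos[of "map_vec Im u"] nonneg[of "map_vec Re u"] nonneg[of "map_vec Im u"] u(1)
    by (auto intro: add_pos_nonneg add_nonneg_pos)
qed

text \<open>The pencil form gives access to the blocks without an inverse. In the quotient for
  \<open>z\<close> the term of \<open>v\<close> is the same above and below, so the norm equivalence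
  applied to \<open>u\<close> decides the range.\<close>

lemma block_pencil_eigenvalue:
  fixes M L A :: "real mat"
  assumes M: "M \<in> carrier_mat N N" and L: "L \<in> carrier_mat N N" and A: "A \<in> carrier_mat N N"
    and sym: "\<And>i j. i < N \<Longrightarrow> j < N \<Longrightarrow> M $$ (i, j) = M $$ (j, i)"
      "\<And>i j. i < N \<Longrightarrow> j < N \<Longrightarrow> L $$ (i, j) = L $$ (j, i)"
      "\<And>i j. i < N \<Longrightarrow> j < N \<Longrightarrow> A $$ (i, j) = A $$ (j, i)"
    and pos: "\<And>w. w \<in> carrier_vec N \<Longrightarrow> w \<noteq> 0\<^sub>v N \<Longrightarrow> 0 < scalar_prod (M *\<^sub>v w) w"
    and C: "C \<le> 1"
    and equiv: "\<And>w. w \<in> carrier_vec N \<Longrightarrow> C * scalar_prod (L *\<^sub>v w) w \<le> scalar_prod (M *\<^sub>v w) w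
      \<and> scalar_prod (M *\<^sub>v w) w \<le> scalar_prod (L *\<^sub>v w) w"
    and x: "x \<in> carrier_vec (N + N)" "x \<noteq> 0\<^sub>v (N + N)"
    and eq: "map_mat complex_of_real (four_block_mat A M M (- A)) *\<^sub>v x
      = z \<cdot>\<^sub>v (map_mat complex_of_real (four_block_mat A M L (- A)) *\<^sub>v x)"
  shows "z \<in> complex_of_real ` {C..1}"
proof (cases "z = 1")
  case True
  then show ?thesis using C by (auto intro: image_eqI[of _ _ 1])
next
  case False
  let ?c = "map_mat complex_of_real"
  define u v where "u = vec_first x N" and "v = vec_last x N"
  have uv: "u \<in> carrier_vec N" "v \<in> carrier_vec N" and x_eq: "x = u @\<^sub>v v"
    using x by (auto simp: u_def v_def)
  have A': "- A \<in> carrier_mat N N" using A by simp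
  note cc = M[THEN map_carrier_mat[THEN iffD2], of complex_of_real] L[THEN map_carrier_mat[THEN iffD2], of complex_of_real]
    A[THEN map_carrier_mat[THEN iffD2], of complex_of_real] A'[THEN map_carrier_mat[THEN iffD2], of complex_of_real]
  note vc = cc[THEN mult_mat_vec_carrier, OF uv(1)] cc[THEN mult_mat_vec_carrier, OF uv(2)]
  have smult_append: "z \<cdot>\<^sub>v (a @\<^sub>v b) = z \<cdot>\<^sub>v a @\<^sub>v z \<cdot>\<^sub>v b" for a b :: "complex Matrix.vec"
    by (rule eq_vecI) auto
  have neg: "?c (- A) *\<^sub>v v = - (?c A *\<^sub>v v)"
    using A uv by (intro eq_vecI) (auto simp: scalar_prod_def sum_negf)
  have "(?c A *\<^sub>v u + ?c M *\<^sub>v v) @\<^sub>v (?c M *\<^sub>v u + ?c (- A) *\<^sub>v v)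
      = (z \<cdot>\<^sub>v (?c A *\<^sub>v u + ?c M *\<^sub>v v)) @\<^sub>v (z \<cdot>\<^sub>v (?c L *\<^sub>v u + ?c (- A) *\<^sub>v v))"
    using eq unfolding x_eq map_four_block_mat[OF A M M A'] map_four_block_mat[OF A M L A']
      four_block_mat_mult_vec[OF cc(3,1,1,4) uv] four_block_mat_mult_vec[OF cc(3,1,2,4) uv] smult_append .
  then have e1: "?c A *\<^sub>v u + ?c M *\<^sub>v v = z \<cdot>\<^sub>v (?c A *\<^sub>v u + ?c M *\<^sub>v v)"
    and e2: "?c M *\<^sub>v u + ?c (- A) *\<^sub>v v = z \<cdot>\<^sub>v (?c L *\<^sub>v u + ?c (- A) *\<^sub>v v)"
    using vc append_vec_eq[of "?c A *\<^sub>v u + ?c M *\<^sub>v v" N "z \<cdot>\<^sub>v (?c A *\<^sub>v u + ?c M *\<^sub>v v)"] by auto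
  define form where "form G y w = scalar_prod (?c G *\<^sub>v y) (conjugate w)" for G y w
  define quad where "quad G w = scalar_prod (G *\<^sub>v map_vec Re w) (map_vec Re w)
      + scalar_prod (G *\<^sub>v map_vec Im w) (map_vec Im w)" for G w
  have quad: "form M u u = quad M u" "form M v v = quad M v" "form L u u = quad L u"
    unfolding form_def quad_def
    by (rule hermitian_form_real[OF M sym(1) uv(1)] hermitian_form_real[OF M sym(1) uv(2)]
        hermitian_form_real[OF L sym(2) uv(1)]; assumption)+
  \<comment> \<open>The two matrices share their first block row, so testing it with
    \<open>v\<close> leaves the factor \<open>1 - z\<close>, which is nonzero here.\<close>
  have "form A u v + form M v v = 0"
  proof -
    have "form A u v + form M v v = z * (form A u v + form M v v)"
      using arg_cong[OF e1, of "\<lambda>y. scalar_prod y (conjugate v)"] vc uv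
      by (simp add: form_def add_scalar_prod_distrib[of _ N] smult_scalar_prod_distrib[of _ N])
    then have "(1 - z) * (form A u v + form M v v) = 0"
      by (simp only: left_diff_distrib mult_1 right_minus_eq)
    with False show ?thesis by simp
  qed
  \<comment> \<open>The value \<open>- quad M v\<close> is real, so conjugation does not change it
    and it can be inserted into the second block row.\<close>
  moreover have "form A v u = cnj (form A u v)"
    unfolding form_def by (rule hermitian_form_adjoint[OF A sym(3) uv])
  ultimately have "form A v u = - quad M v"
    by (simp add: quad eq_neg_iff_add_eq_0[symmetric])
  moreover have "form M u u - form A v u = z * (form L u u - form A v u)"
    using arg_cong[OF e2, of "\<lambda>y. scalar_prod y (conjugate u)"] vc uv
    by (simp add: form_def neg add_scalar_prod_distrib[of _ N] smult_scalar_prod_distrib[of _ N]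
          uminus_scalar_prod[of _ N, symmetric])
  ultimately have z: "complex_of_real (quad M u + quad M v) = z * complex_of_real (quad L u + quad M v)"
    by (simp add: quad)
  have nonneg: "0 \<le> quad M w" and pos_quad: "w \<noteq> 0\<^sub>v N \<Longrightarrow> 0 < quad M w" if "w \<in> carrier_vec N" for w
  proof -
    show *: "0 < quad M w" if "w \<noteq> 0\<^sub>v N"
      using positive_hermitian_form[OF M pos \<open>w \<in> carrier_vec N\<close> that] by (simp add: quad_def)
    show "0 \<le> quad M w"
    proof (cases "w = 0\<^sub>v N")
      case True
      then show ?thesis using M by (auto simp: quad_def scalar_prod_def)
    qed (use * in auto)
  qed
  have le: "C * quad L u \<le> quad M u" "quad M u \<le> quad L u"
    using equiv[of "map_vec Re u"] equiv[of "map_vec Im u"] uv by (auto simp: quad_def algebra_simps)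
  \<comment> \<open>The denominator is positive: the form of \<open>L\<close> dominates that of
    \<open>M\<close>, which is positive definite.\<close>
  have "u \<noteq> 0\<^sub>v N \<or> v \<noteq> 0\<^sub>v N"
    using x(2) unfolding x_eq by (metis zero_vec_append)
  then have den: "0 < quad L u + quad M v"
    using nonneg[OF uv(1)] nonneg[OF uv(2)] pos_quad[OF uv(1)] pos_quad[OF uv(2)] le(2) by fastforce
  \<comment> \<open>As \<open>C \<le> 1\<close>, the lower bound extends from the term of
    \<open>u\<close> to the whole quotient.\<close>
  have "C * quad M v \<le> quad M v" using C nonneg[OF uv(2)] mult_right_mono[of C 1 "quad M v"] by simp
  then have "(quad M u + quad M v) / (quad L u + quad M v) \<in> {C..1}"
    using den le by (simp add: field_simps)
  moreover have "z = complex_of_real ((quad M u + quad M v) / (quad L u + quad M v))"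
    using z den by (simp add: field_simps flip: of_real_add)
  ultimately show ?thesis by blast
qed

text \<open>For a kernel vector, test the first block row with \<open>v\<close> and the second with
  \<open>u\<close>. In the sum the terms of \<open>A\<close> cancel by symmetry, and two nonnegative
  forms add up to 0.\<close>

lemma block_mat_invertible:
  fixes M L A :: "real mat"
  assumes M: "M \<in> carrier_mat N N" and L: "L \<in> carrier_mat N N" and A: "A \<in> carrier_mat N N"
    and sym: "\<And>i j. i < N \<Longrightarrow> j < N \<Longrightarrow> A $$ (i, j) = A $$ (j, i)"
    and pos: "\<And>w. w \<in> carrier_vec N \<Longrightarrow> w \<noteq> 0\<^sub>v N \<Longrightarrow> 0 < scalar_prod (M *\<^sub>v w) w"
      "\<And>w. w \<in> carrier_vec N \<Longrightarrow> w \<noteq> 0\<^sub>v N \<Longrightarrow> 0 < scalar_prod (L *\<^sub>v w) w"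
  shows "invertible_mat (four_block_mat A M L (- A))"
proof (rule invertible_mat_if_inj)
  have A': "- A \<in> carrier_mat N N" using A by simp
  show "four_block_mat A M L (- A) \<in> carrier_mat (N + N) (N + N)"
    by (rule four_block_carrier_mat[OF A A'])
  fix x :: "real Matrix.vec"
  assume x: "x \<in> carrier_vec (N + N)" and 0: "four_block_mat A M L (- A) *\<^sub>v x = 0\<^sub>v (N + N)"
  define u v where "u = vec_first x N" and "v = vec_last x N"
  have uv: "u \<in> carrier_vec N" "v \<in> carrier_vec N" and x_eq: "x = u @\<^sub>v v"
    using x by (auto simp: u_def v_def)
  note vc = M[THEN mult_mat_vec_carrier, OF uv(2)] L[THEN mult_mat_vec_carrier, OF uv(1)]
    A[THEN mult_mat_vec_carrier, OF uv(1)] A[THEN mult_mat_vec_carrier, OF uv(2)]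
  have neg: "- A *\<^sub>v v = - (A *\<^sub>v v)"
    using A uv by (intro eq_vecI) (auto simp: scalar_prod_def sum_negf)
  have "(A *\<^sub>v u + M *\<^sub>v v) @\<^sub>v (L *\<^sub>v u + - A *\<^sub>v v) = 0\<^sub>v N @\<^sub>v 0\<^sub>v N"
    using 0 unfolding x_eq four_block_mat_mult_vec[OF A M L A' uv] zero_vec_append .
  then have e: "A *\<^sub>v u + M *\<^sub>v v = 0\<^sub>v N" "L *\<^sub>v u + - A *\<^sub>v v = 0\<^sub>v N"
    using vc append_vec_eq[of "A *\<^sub>v u + M *\<^sub>v v" N "0\<^sub>v N"] by auto
  have "scalar_prod (A *\<^sub>v u) v + scalar_prod (M *\<^sub>v v) v = 0"
    using arg_cong[OF e(1), of "\<lambda>y. scalar_prod y v"] vc uv by (simp add: add_scalar_prod_distrib[of _ N])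
  moreover have "scalar_prod (L *\<^sub>v u) u - scalar_prod (A *\<^sub>v v) u = 0"
    using arg_cong[OF e(2), of "\<lambda>y. scalar_prod y u"] vc uv
    by (simp add: neg add_scalar_prod_distrib[of _ N] uminus_scalar_prod[of _ N, symmetric])
  moreover have "scalar_prod (A *\<^sub>v u) v = scalar_prod (A *\<^sub>v v) u"
  proof -
    have "A\<^sup>T = A" using A sym by (intro eq_matI) auto
    then show ?thesis
      using transpose_vec_mult_scalar[OF A uv(1,2)] uv vc by (simp add: comm_scalar_prod[of v N])
  qed
  ultimately have sum0: "scalar_prod (L *\<^sub>v u) u + scalar_prod (M *\<^sub>v v) v = 0" by linarith
  have nonneg: "0 \<le> scalar_prod (L *\<^sub>v u) u" "0 \<le> scalar_prod (M *\<^sub>v v) v"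
    using pos(2)[OF uv(1)] pos(1)[OF uv(2)] uv L M
    by (cases "u = 0\<^sub>v N"; auto simp: scalar_prod_def less_imp_le)
       (cases "v = 0\<^sub>v N"; use pos(1)[OF uv(2)] M in \<open>auto simp: scalar_prod_def less_imp_le\<close>)
  have "u = 0\<^sub>v N" "v = 0\<^sub>v N" using pos(2)[OF uv(1)] pos(1)[OF uv(2)] nonneg sum0 by force+
  then show "x = 0\<^sub>v (N + N)" by (simp add: x_eq zero_vec_append)
qed

text \<open>Substitute \<open>y = Q x\<close> in the eigenvalue equation; \<open>x\<close> is
  nonzero because its image \<open>y\<close> is.\<close>

lemma eigenvalue_mult_mat_inv:
  assumes P: "P \<in> carrier_mat n n" and Q: "Q \<in> carrier_mat n n" "invertible_mat Q"
    and ev: "eigenvalue (map_mat complex_of_real (P * mat_inv Q)) z"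
  obtains x where "x \<in> carrier_vec n" "x \<noteq> 0\<^sub>v n"
    "map_mat complex_of_real P *\<^sub>v x = z \<cdot>\<^sub>v (map_mat complex_of_real Q *\<^sub>v x)"
proof -
  let ?c = "map_mat complex_of_real"
  note Qi = mat_inv_props[OF Q]
  have cc: "?c P \<in> carrier_mat n n" "?c Q \<in> carrier_mat n n" "?c (mat_inv Q) \<in> carrier_mat n n"
    using P Q Qi by auto
  obtain y where y: "y \<in> carrier_vec n" "y \<noteq> 0\<^sub>v n" and eq: "?c (P * mat_inv Q) *\<^sub>v y = z \<cdot>\<^sub>v y"
    using ev P by (auto simp: eigenvalue_def eigenvector_def)
  define x where "x = ?c (mat_inv Q) *\<^sub>v y"
  have x: "x \<in> carrier_vec n" unfolding x_def using cc(3) y(1) by (rule mult_mat_vec_carrier)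
  have "?c Q *\<^sub>v x = ?c (Q * mat_inv Q) *\<^sub>v y"
    unfolding x_def of_real_hom.mat_hom_mult[OF Q(1) Qi(1)] assoc_mult_mat_vec[OF cc(2,3) y(1)] ..
  also have "\<dots> = y" unfolding Qi(2) of_real_hom.mat_hom_one using y by simp
  finally have Qx: "?c Q *\<^sub>v x = y" .
  have "?c P *\<^sub>v x = ?c (P * mat_inv Q) *\<^sub>v y"
    unfolding x_def of_real_hom.mat_hom_mult[OF P Qi(1)] assoc_mult_mat_vec[OF cc(1,3) y(1)] ..
  then have "?c P *\<^sub>v x = z \<cdot>\<^sub>v (?c Q *\<^sub>v x)" unfolding Qx eq .
  moreover have "x \<noteq> 0\<^sub>v n"
  proof
    assume "x = 0\<^sub>v n"
    then have "?c Q *\<^sub>v x = 0\<^sub>v n" using cc(2) by (intro eq_vecI) (auto simp: scalar_prod_def)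
    with Qx y show False by simp
  qed
  ultimately show thesis using that x by blast
qed

section \<open>Symmetry and positivity of the finite element matrices\<close>

lemma set_integrable_lebesgue_continuous:
  fixes f :: "'a :: euclidean_space \<Rightarrow> real"
  assumes "open S" "bounded S" and f: "continuous_on (closure S) f"
  shows "set_integrable lebesgue S f"
proof (rule set_integrable_subset)
  \<comment> \<open>Continuity on the compact closure gives Borel integrability, which passes to the
    completed measure.\<close>
  have "integrable lborel (\<lambda>x. indicat_real (closure S) x *\<^sub>R f x)"
    using assms by (intro borel_integrable_compact) auto
  then show "set_integrable lebesgue (closure S) f"
    unfolding set_integrable_def
    by (simp add: integrable_completion borel_measurable_integrable)
qed (use assms closure_subset in auto)

text \<open>By continuity \<open>f\<close> is nonzero on a nonempty open set. Such a set is not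
  negligible, which rules out the value 0.\<close>

lemma set_integral_power2_pos:
  fixes f :: "'a :: euclidean_space \<Rightarrow> real"
  assumes S: "open S" "bounded S" and f: "continuous_on (closure S) f" and z: "z \<in> S" "f z \<noteq> 0"
  shows "0 < (LINT x:S|lebesgue. (f x)\<^sup>2)"
proof -
  let ?g = "\<lambda>x. indicat_real S x *\<^sub>R (f x)\<^sup>2"
  have int: "integrable lebesgue ?g"
    using set_integrable_lebesgue_continuous[OF S, of "\<lambda>x. (f x)\<^sup>2"] f
    by (simp add: set_integrable_def continuous_on_power)
  define U where "U = S \<inter> f -` (- {0})"
  have "open U"
    unfolding U_def using S f closure_subset continuous_on_subset
    by (intro continuous_open_preimage) blast+
  have "integral\<^sup>L lebesgue ?g \<noteq> 0"
  proof
    assume "integral\<^sup>L lebesgue ?g = 0"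
    then have "AE x in lebesgue. ?g x = 0"
      using integral_nonneg_eq_0_iff_AE[OF int] by auto
    then have "AE x in lebesgue. x \<notin> U"
      by eventually_elim (auto simp: U_def)
    then have "negligible U"
      unfolding negligible_iff_null_sets using \<open>open U\<close> by (subst (asm) AE_iff_null_sets[symmetric]) auto
    then show False using open_not_negligible[OF \<open>open U\<close>] z by (auto simp: U_def)
  qed
  moreover have "0 \<le> integral\<^sup>L lebesgue ?g" by (rule Bochner_Integration.integral_nonneg) simp
  ultimately show ?thesis unfolding set_lebesgue_integral_def by linarith
qed

lemma mass_matrix_carrier [simp]: "mass_matrix \<Omega> N \<phi> \<in> carrier_mat N N"
  by (simp add: mass_matrix_def)

lemma mass_matrix_sym: "i < N \<Longrightarrow> j < N \<Longrightarrow> mass_matrix \<Omega> N \<phi> $$ (i, j) = mass_matrix \<Omega> N \<phi> $$ (j, i)"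
  by (simp add: mass_matrix_def mult.commute)

lemma stiffness_matrix_carrier [simp]: "stiffness_matrix \<Omega> a N \<phi> \<in> carrier_mat N N"
  by (simp add: stiffness_matrix_def)

lemma stiffness_matrix_sym:
  assumes a: "diffusion_coefficient \<Omega> a" and ij: "i < N" "j < N"
  shows "stiffness_matrix \<Omega> a N \<phi> $$ (i, j) = stiffness_matrix \<Omega> a N \<phi> $$ (j, i)"
proof -
  have "(a x *v p) \<bullet> q = (a x *v q) \<bullet> p" if "x \<in> \<Omega>" for x p q
  proof -
    have "(a x *v p) \<bullet> q = p \<bullet> (Finite_Cartesian_Product.transpose (a x) *v q)"
      by (metis dot_lmul_matrix inner_commute transpose_matrix_vector)
    moreover have "Finite_Cartesian_Product.transpose (a x) = a x"
      using a that by (simp add: diffusion_coefficient_def)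
    ultimately show ?thesis by (simp add: inner_commute del: transpose_matrix_vector)
  qed
  \<comment> \<open>The indicator removes all points outside \<open>\<Omega>\<close>, where nothing
    is known about the symmetry of \<open>a\<close>.\<close>
  then show ?thesis using ij
    by (auto simp: stiffness_matrix_def set_lebesgue_integral_def indicator_def intro!: Bochner_Integration.integral_cong)
qed

text \<open>The form is the integral of the square of the finite element function \<open>u\<close>
  with nodal values \<open>w\<close>; a nonzero entry of \<open>w\<close> is a nonzero value of
  \<open>u\<close> at an interior node.\<close>

lemma mass_matrix_pos:
  assumes \<Omega>: "open \<Omega>" "bounded \<Omega>" and nb: "nodal_basis \<Omega> \<T> \<phi>"
    and w: "w \<in> carrier_vec (fe_dim \<Omega> \<T>)" "w \<noteq> 0\<^sub>v (fe_dim \<Omega> \<T>)"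
  shows "0 < scalar_prod (mass_matrix \<Omega> (fe_dim \<Omega> \<T>) \<phi> *\<^sub>v w) w"
proof -
  define N where "N = fe_dim \<Omega> \<T>"
  note w = w[folded N_def]
  define u where "u x = (\<Sum>i<N. vec_index w i * \<phi> i x)" for x
  obtain z where "bij_betw z {..<N} (interior_nodes \<Omega> \<T>)" "\<forall>i<N. \<forall>j<N. \<phi> i (z j) = of_bool (i = j)"
    using nb unfolding nodal_basis_def Let_def N_def[symmetric] by blast
  then have z: "j < N \<Longrightarrow> z j \<in> \<Omega>" "i < N \<Longrightarrow> j < N \<Longrightarrow> \<phi> i (z j) = of_bool (i = j)" for i j
    using bij_betwE by (fastforce simp: interior_nodes_def)+
  have "\<phi> i \<in> fe_space \<Omega> \<T>" if "i < N" for i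
    using nb fun_vs.span_base[of "\<phi> i" "\<phi> ` {..<N}"] that
    unfolding nodal_basis_def Let_def N_def[symmetric] by auto
  then have cont: "continuous_on (closure \<Omega>) (\<phi> i)" if "i < N" for i
    using that by (auto simp: fe_space_def)
  obtain j where j: "j < N" "vec_index w j \<noteq> 0"
    using w by (metis carrier_vecD eq_vecI index_zero_vec(1) index_zero_vec(2))
  have "u (z j) = (\<Sum>i<N. if i = j then vec_index w i else 0)"
    unfolding u_def using z(2) j by (intro sum.cong) auto
  then have "u (z j) \<noteq> 0" using j by simp
  then have "0 < (LINT x:\<Omega>|lebesgue. (u x)\<^sup>2)"
    using \<Omega> z(1)[OF j(1)] cont
    by (intro set_integral_power2_pos[where z = "z j"]) (auto simp: u_def intro!: continuous_intros)
  also have "(LINT x:\<Omega>|lebesgue. (u x)\<^sup>2)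
      = integral\<^sup>L lebesgue (\<lambda>x. \<Sum>i<N. \<Sum>k<N.
          vec_index w i * vec_index w k * (indicat_real \<Omega> x *\<^sub>R (\<phi> i x * \<phi> k x)))"
    unfolding set_lebesgue_integral_def
    by (intro Bochner_Integration.integral_cong)
      (auto simp: u_def power2_eq_square sum_product sum_distrib_left mult_ac intro!: sum.cong)
  also have "\<dots> = (\<Sum>i<N. \<Sum>k<N. vec_index w i * vec_index w k * (LINT x:\<Omega>|lebesgue. \<phi> i x * \<phi> k x))"
  proof -
    have "integrable lebesgue (\<lambda>x. indicat_real \<Omega> x *\<^sub>R (\<phi> i x * \<phi> k x))" if "i < N" "k < N" for i k
      using set_integrable_lebesgue_continuous[OF \<Omega>, of "\<lambda>x. \<phi> i x * \<phi> k x"] cont that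
      by (simp add: set_integrable_def continuous_on_mult)
    then have int: "integrable lebesgue (\<lambda>x. vec_index w i * vec_index w k * (indicat_real \<Omega> x *\<^sub>R (\<phi> i x * \<phi> k x)))"
      if "i < N" "k < N" for i k
      using that by (intro integrable_mult_right) blast
    have "integral\<^sup>L lebesgue (\<lambda>x. \<Sum>k<N. vec_index w i * vec_index w k * (indicat_real \<Omega> x *\<^sub>R (\<phi> i x * \<phi> k x)))
        = (\<Sum>k<N. vec_index w i * vec_index w k * (LINT x:\<Omega>|lebesgue. \<phi> i x * \<phi> k x))" if "i < N" for i
      unfolding set_lebesgue_integral_def integral_mult_right_zero[symmetric]
      using int that by (intro Bochner_Integration.integral_sum) blast
    then show ?thesis
      using int by (subst Bochner_Integration.integral_sum) (auto intro!: Bochner_Integration.integrable_sum)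
  qed
  also have "\<dots> = scalar_prod (mass_matrix \<Omega> N \<phi> *\<^sub>v w) w"
    using w by (auto simp: mass_matrix_def scalar_prod_def lessThan_atLeast0 sum_distrib_right sum_distrib_left
        mult_ac intro!: sum.cong)
  finally show ?thesis by (simp add: N_def)
qed

subsection \<open>Convergence of GMRes\<close>

text \<open>From ratio 2 on, each term is at least as large as the sum bound for the terms before
  it. The ratio used later is \<open>4 / C\<close>.\<close>

lemma sum_power_le_last:
  fixes r :: real
  assumes "2 \<le> r" "0 < m"
  shows "(\<Sum>d<m. r ^ d) \<le> 2 * r ^ (m - 1)"
  using assms(2)
proof (induction m rule: nat_induct_non_zero)
  case (Suc m)
  have "2 * r ^ (m - 1) \<le> r * r ^ (m - 1)" using assms by (intro mult_right_mono) auto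
  also have "\<dots> = r ^ m" using Suc by (cases m) auto
  finally show ?case using Suc by simp
qed simp

lemma max_block_size_pos:
  assumes "R \<in> carrier_mat n n" "0 < n" "jordan_transformation R V n_as"
  shows "0 < max_block_size n_as"
proof -
  have "n_as \<noteq> []" using jordan_transformation_size[OF assms(1,3)] assms(2) by auto
  then have "max_block_size n_as \<in> fst ` set n_as"
    unfolding max_block_size_def by (intro Max_in) auto
  moreover have "0 \<notin> fst ` set n_as" using assms(3) by (simp add: jordan_transformation_def)
  ultimately show ?thesis by (metis gr0I)
qed

text \<open>The remaining factor of \<open>C_R\<close> is at least 1. The Jordan estimate produces
  \<open>condition_number V\<close>, which can thus be replaced by \<open>C_R\<close>.\<close>

lemma condition_number_le_C_R:
  assumes R: "R \<in> carrier_mat n n" and n: "0 < n" and jt: "jordan_transformation R V n_as"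
  shows "1 \<le> condition_number V" "condition_number V \<le> C_R R V n_as"
proof -
  show \<kappa>: "1 \<le> condition_number V"
    using R n jt by (intro condition_number_ge_1[of V n]) (auto simp: jordan_transformation_def)
  have "1 \<le> real n * (1 + sqrt (real n - real (num_blocks n_as)))"
    using n num_blocks_le[OF R jt] mult_mono[of 1 "real n" 1 "1 + sqrt (real n - real (num_blocks n_as))"]
    by simp
  then show "condition_number V \<le> C_R R V n_as"
    using R \<kappa> mult_right_mono[of 1 "real n * (1 + sqrt (real n - real (num_blocks n_as)))" "condition_number V"]
    by (simp add: C_R_def Let_def)
qed

lemma gmres_residual_bound:
  assumes R: "R \<in> carrier_mat n n" and C: "0 < C" "C < 1"
    and ev: "\<And>z. eigenvalue (map_mat complex_of_real R) z \<Longrightarrow> z \<in> complex_of_real ` {C..1}"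
    and it: "gmres_iteration R f v" and jt: "jordan_transformation R V n_as"
  defines "m \<equiv> max_block_size n_as"
  shows "vnorm (residual R f v k)
    \<le> condition_number V * (2 ^ (2 * m - 1) / C ^ (m - 1)) * ((1 - C / 2) / (1 + C)) ^ k * vnorm (residual R f v 0)"
proof -
  have r0: "residual R f v 0 \<in> carrier_vec n" "residual R f v 0 \<noteq> 0\<^sub>v n"
    using it R by (auto simp: gmres_iteration_def residual_def Let_def)
  then have n: "0 < n" by (cases n) auto
  \<comment> \<open>The midpoint of the interval \<open>{C..1}\<close> that contains the
    spectrum.\<close>
  define c where "c = (1 + C) / 2"
  have c: "0 < c" using C by (simp add: c_def)
  let ?p = "[:1, - 1 / c:] ^ k"
  have "norm (z - complex_of_real c) \<le> (1 - C) / 2" if z: "eigenvalue (map_mat complex_of_real R) z" for z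
  proof -
    obtain t where "t \<in> {C..1}" "z = complex_of_real t" using ev[OF z] by blast
    moreover from this have "norm (z - complex_of_real c) = \<bar>t - c\<bar>" by (simp flip: of_real_diff)
    ultimately show ?thesis by (auto simp: c_def abs_le_iff field_simps)
  qed
  \<comment> \<open>The radius \<rho> is half the length of the interval; \<epsilon> is the
    enlargement \<open>C / 4\<close>.\<close>
  moreover have "0 \<le> (1 - C) / 2" "0 < C / 4" using C by simp_all
  ultimately have bound: "vnorm (mat_poly ?p R *\<^sub>v residual R f v 0) \<le> condition_number V
      * (\<Sum>d<max_block_size n_as. (1 / (C / 4)) ^ d) * (((1 - C) / 2 + C / 4) / c) ^ k * vnorm (residual R f v 0)"
    by (intro vnorm_mat_poly_linear_power_le[OF R jt r0(1) c]) blast+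
  have "vnorm (residual R f v k) \<le> vnorm (mat_poly ?p R *\<^sub>v residual R f v 0)"
  proof (rule gmres_residual_le[OF it])
    show "degree ?p \<le> k" by (rule order_trans[OF degree_power_le]) simp
    show "poly ?p 0 = 1" by (simp add: poly_power)
  qed
  also have "\<dots> \<le> condition_number V * (\<Sum>d<m. (4 / C) ^ d) * ((1 - C / 2) / (1 + C)) ^ k * vnorm (residual R f v 0)"
  proof -
    \<comment> \<open>The enlarged radius relative to the midpoint is exactly the rate
      \<theta>.\<close>
    have "((1 - C) / 2 + C / 4) / c = (1 - C / 2) / (1 + C)"
    proof -
      have "(1 - C) / 2 + C / 4 = (1 - C / 2) / 2" by (simp add: diff_divide_distrib)
      then show ?thesis by (simp add: c_def)
    qed
    moreover have "1 / (C / 4) = 4 / C" by simp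
    ultimately show ?thesis using bound unfolding m_def by (simp only:)
  qed
  also have "\<dots> \<le> condition_number V * (2 ^ (2 * m - 1) / C ^ (m - 1)) * ((1 - C / 2) / (1 + C)) ^ k * vnorm (residual R f v 0)"
  proof -
    have m: "0 < m" unfolding m_def by (rule max_block_size_pos[OF R n jt])
    have "(\<Sum>d<m. (4 / C) ^ d) \<le> 2 * (4 / C) ^ (m - 1)"
      using C m by (intro sum_power_le_last) (simp_all add: field_simps)
    \<comment> \<open>Since \<open>m\<close> is positive, \<open>2 * 4 ^ (m - 1)\<close> is the odd
      power \<open>2 ^ (2 * m - 1)\<close>.\<close>
    also have "\<dots> = 2 ^ (2 * m - 1) / C ^ (m - 1)"
    proof -
      obtain l where l: "m = Suc l" using m gr0_implies_Suc by blast
      show ?thesis by (simp add: l power_divide power_mult)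
    qed
    finally show ?thesis
      using C condition_number_le_C_R(1)[OF R n jt]
      by (intro mult_right_mono mult_left_mono) auto
  qed
  finally show ?thesis .
qed

text \<open>Invertibility of \<open>\<B>\<close> is part of the conclusion since it gives
  \<open>mat_inv \<B>\<close> its meaning. \<open>C\<^sub>1\<close> is fixed for the whole mesh
  family, which makes \<theta> independent of the mesh and of \<tau>.\<close>

theorem corollary3:
  fixes \<Omega> :: "(real^'d) set"
    and a b :: "real^'d \<Rightarrow> real^'d^'d"
    and \<TT> :: "(real^'d) set set set"
    and \<T> :: "(real^'d) set set"
    and \<phi> :: "(real^'d) set set \<Rightarrow> nat \<Rightarrow> real^'d \<Rightarrow> real"
    and \<sigma> C\<^sub>1 \<tau> \<theta> :: real
    and N :: nat
    and M A B \<A> \<B> R :: "real mat"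
  assumes "polyhedral_domain \<Omega>"
    and "diffusion_coefficient \<Omega> a" and "diffusion_coefficient \<Omega> b"
    and "shape_regular_family \<Omega> \<sigma> \<TT>"
    and "\<forall>\<S>\<in>\<TT>. nodal_basis \<Omega> \<S> (\<phi> \<S>)"
    and "0 < C\<^sub>1" and "C\<^sub>1 < 1"
    and "\<forall>\<S>\<in>\<TT>. \<forall>w \<in> carrier_vec (fe_dim \<Omega> \<S>).
           let M' = mass_matrix \<Omega> (fe_dim \<Omega> \<S>) (\<phi> \<S>) in
             C\<^sub>1 * scalar_prod (lumped M' *\<^sub>v w) w \<le> scalar_prod (M' *\<^sub>v w) w \<and>
             scalar_prod (M' *\<^sub>v w) w \<le> scalar_prod (lumped M' *\<^sub>v w) w"
    and "\<T> \<in> \<TT>" and "0 < \<tau>"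
    and "N = fe_dim \<Omega> \<T>"
    and "M = mass_matrix \<Omega> N (\<phi> \<T>)"
    and "A = stiffness_matrix \<Omega> a N (\<phi> \<T>)"
    and "B = stiffness_matrix \<Omega> b N (\<phi> \<T>)"
    and "A = B"
    and "\<A> = four_block_mat (\<tau> \<cdot>\<^sub>m A) M M (- (\<tau> \<cdot>\<^sub>m B))"
    and "\<B> = four_block_mat (\<tau> \<cdot>\<^sub>m A) M (lumped M) (- (\<tau> \<cdot>\<^sub>m B))"
    and "R = \<A> * mat_inv \<B>"
    and "\<theta> = (1 - C\<^sub>1 / 2) / (1 + C\<^sub>1)"
  shows "invertible_mat \<B> \<and>
    (\<forall>f v. gmres_iteration R f v \<longrightarrow>
       asymptotic_linear_rate (residual R f v) \<theta> \<and>
       (\<forall>V n_as k. jordan_transformation R V n_as \<longrightarrow>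
          (let m = max_block_size n_as;
               C\<^sub>0 = 2 ^ (2 * m - 1) * C_R R V n_as ^ m * real N / C\<^sub>1 ^ (m - 1)
           in vnorm (residual R f v k) / vnorm (residual R f v 0) \<le> C\<^sub>0 * \<theta> ^ k)))"
proof -
  note nb = assms(5) and C = assms(6,7) and equiv = assms(8) and \<T> = assms(9) and \<tau> = assms(10)
    and N = assms(11) and M = assms(12) and A = assms(13) and AB = assms(15)
    and \<A> = assms(16) and \<B> = assms(17) and R_eq = assms(18) and \<theta> = assms(19)
  have \<Omega>: "open \<Omega>" "bounded \<Omega>" using assms(1) by (auto simp: polyhedral_domain_def)
  have carrier: "M \<in> carrier_mat N N" "lumped M \<in> carrier_mat N N" "\<tau> \<cdot>\<^sub>m A \<in> carrier_mat N N"
    by (auto simp: M A lumped_def mass_matrix_def mat_diag_def)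
  have A_carrier: "A \<in> carrier_mat N N" by (simp add: A)
  have sym: "M $$ (i, j) = M $$ (j, i)" "lumped M $$ (i, j) = lumped M $$ (j, i)"
    "(\<tau> \<cdot>\<^sub>m A) $$ (i, j) = (\<tau> \<cdot>\<^sub>m A) $$ (j, i)" if "i < N" "j < N" for i j
  proof -
    have "A $$ (i, j) = A $$ (j, i)" unfolding A by (rule stiffness_matrix_sym[OF assms(2) that])
    then show "(\<tau> \<cdot>\<^sub>m A) $$ (i, j) = (\<tau> \<cdot>\<^sub>m A) $$ (j, i)" using A_carrier that by simp
    show "M $$ (i, j) = M $$ (j, i)" unfolding M by (rule mass_matrix_sym[OF that])
    show "lumped M $$ (i, j) = lumped M $$ (j, i)"
      using carrier(1) that by (simp add: lumped_def mat_diag_def)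
  qed
  have pos: "0 < scalar_prod (M *\<^sub>v w) w" if "w \<in> carrier_vec N" "w \<noteq> 0\<^sub>v N" for w
    using mass_matrix_pos[OF \<Omega> bspec[OF nb \<T>]] that by (simp add: M N)
  have equiv': "C\<^sub>1 * scalar_prod (lumped M *\<^sub>v w) w \<le> scalar_prod (M *\<^sub>v w) w \<and>
      scalar_prod (M *\<^sub>v w) w \<le> scalar_prod (lumped M *\<^sub>v w) w" if "w \<in> carrier_vec N" for w
    using bspec[OF equiv \<T>] that by (simp add: M N Let_def)
  \<comment> \<open>Positivity passes from \<open>M\<close> to the lumped matrix through the upper
    half of the norm equivalence.\<close>
  have pos_lumped: "0 < scalar_prod (lumped M *\<^sub>v w) w" if "w \<in> carrier_vec N" "w \<noteq> 0\<^sub>v N" for w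
    using pos[OF that] equiv'[OF that(1)] by linarith
  have inv: "invertible_mat \<B>"
    unfolding \<B> AB[symmetric] by (rule block_mat_invertible[OF carrier sym(3) pos pos_lumped])
  have \<A>\<B>: "\<A> \<in> carrier_mat (N + N) (N + N)" "\<B> \<in> carrier_mat (N + N) (N + N)"
    using carrier by (auto simp: \<A> \<B> AB[symmetric])
  have R: "R \<in> carrier_mat (N + N) (N + N)"
    unfolding R_eq using \<A>\<B>(1) mat_inv_props(1)[OF \<A>\<B>(2) inv] by (rule mult_carrier_mat)
  have ev: "z \<in> complex_of_real ` {C\<^sub>1..1}" if z: "eigenvalue (map_mat complex_of_real R) z" for z
  proof -
    obtain x where x: "x \<in> carrier_vec (N + N)" "x \<noteq> 0\<^sub>v (N + N)"
      "map_mat complex_of_real \<A> *\<^sub>v x = z \<cdot>\<^sub>v (map_mat complex_of_real \<B> *\<^sub>v x)"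
      using eigenvalue_mult_mat_inv[OF \<A>\<B> inv z[unfolded R_eq]] .
    show ?thesis
      using block_pencil_eigenvalue[OF carrier sym pos _ equiv' x(1,2) x(3)[unfolded \<A> \<B> AB[symmetric]]] C
      by simp
  qed
  have \<theta>0: "0 \<le> \<theta>" using C by (simp add: \<theta>)
  have "asymptotic_linear_rate (residual R f v) \<theta> \<and>
      (\<forall>V n_as k. jordan_transformation R V n_as \<longrightarrow>
        (let m = max_block_size n_as;
             C\<^sub>0 = 2 ^ (2 * m - 1) * C_R R V n_as ^ m * real N / C\<^sub>1 ^ (m - 1)
         in vnorm (residual R f v k) / vnorm (residual R f v 0) \<le> C\<^sub>0 * \<theta> ^ k))"
    if it: "gmres_iteration R f v" for f v
  proof -
    have bound: "vnorm (residual R f v k) \<le> condition_number V * (2 ^ (2 * max_block_size n_as - 1)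
        / C\<^sub>1 ^ (max_block_size n_as - 1)) * \<theta> ^ k * vnorm (residual R f v 0)"
      if "jordan_transformation R V n_as" for V n_as k
      unfolding \<theta> by (rule gmres_residual_bound[OF R C ev it that])
    have r0: "residual R f v 0 \<in> carrier_vec (N + N)" "residual R f v 0 \<noteq> 0\<^sub>v (N + N)"
      using it R by (auto simp: gmres_iteration_def residual_def Let_def)
    \<comment> \<open>A nonzero residual excludes the empty system, so \<open>real N\<close> is at
      least 1 in the final constant.\<close>
    then have n: "0 < N" by (cases N) auto
    have r0_pos: "0 < vnorm (residual R f v 0)"
      using vnorm_eq_0_iff[OF r0(1)] r0(2) vnorm_nonneg[of "residual R f v 0"] by linarith
    \<comment> \<open>Any one Jordan transformation supplies a constant that does not depend on
      \<open>k\<close>.\<close>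
    have "asymptotic_linear_rate (residual R f v) \<theta>"
      using bound jordan_transformation_exists[OF R] unfolding asymptotic_linear_rate_def by metis
    moreover have "vnorm (residual R f v k) / vnorm (residual R f v 0)
        \<le> 2 ^ (2 * m - 1) * C_R R V n_as ^ m * real N / C\<^sub>1 ^ (m - 1) * \<theta> ^ k"
      if jt: "jordan_transformation R V n_as" and m: "m = max_block_size n_as" for V n_as k m
    proof -
      have "0 < N + N" using n by simp
      note \<kappa> = condition_number_le_C_R[OF R this jt] and m0 = max_block_size_pos[OF R this jt, folded m]
      \<comment> \<open>As \<open>C_R\<close> is at least 1 and \<open>m\<close> is positive, the
        power only enlarges it; with \<open>real N\<close> as a further factor this reaches the
        stated constant.\<close>
      have "C_R R V n_as \<le> C_R R V n_as ^ m" using \<kappa> m0 by (intro self_le_power) auto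
      then have "condition_number V * 1 \<le> C_R R V n_as ^ m * real N"
        using \<kappa> n by (intro mult_mono) auto
      then have "condition_number V * (2 ^ (2 * m - 1) / C\<^sub>1 ^ (m - 1) * \<theta> ^ k)
          \<le> C_R R V n_as ^ m * real N * (2 ^ (2 * m - 1) / C\<^sub>1 ^ (m - 1) * \<theta> ^ k)"
        using C \<theta>0 by (intro mult_right_mono) auto
      moreover have "vnorm (residual R f v k) / vnorm (residual R f v 0)
          \<le> condition_number V * (2 ^ (2 * m - 1) / C\<^sub>1 ^ (m - 1) * \<theta> ^ k)"
        using bound[OF jt, of k] r0_pos by (simp add: m divide_le_eq mult_ac)
      ultimately show ?thesis by (simp add: mult_ac)
    qed
    ultimately show ?thesis by (simp add: Let_def)
  qed
  with inv show ?thesis by blast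
qed

end
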